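(* Let $a,b$ be integers with $2\le a\le b$, let $p>0$ be real, let $q$ be an even integer with $2\le q\le a$, and let $f(x,y)=x^ay^b+x^{a-q}y^{b}e^{-1/|y|^p}$ (with $e^{-1/|y|^p}:=0$ at $y=0$). Let $U$ be a sufficiently small open neighborhood of the origin in $\mathbb{R}^2$. Assume that at least one of the following two conditions is satisfied: (a) $0<p<b/a-1$; (b) $b/a$ is not an odd integer. Assume also that $(b/a-1)/p$ is not an integer. Then for every real-valued $\varphi\in C_0^\infty(U)$ with $\varphi(0,0)\ne 0$, the function $Z_f(\varphi)(s)$ (meromorphically continued to $\mathrm{Re}(s)>-1/a$) cannot be meromorphically continued to any open neighborhood of $s=-1/a$ in $\mathbb{C}$. In particular, $m_0(f)=1/a$.
   Context: $C_0^\infty(U)$ is the set of smooth functions with compact support contained in $U$; "sufficiently small" means contained in some ball about the origin whose radius depends only on $f$. For $\varphi\in C_0^\infty(U)$, $Z_f(\varphi)(s)=\int_{\mathbb{R}^2}|f(x,y)|^s\varphi(x,y)\,dx\,dy$, holomorphic on $\mathrm{Re}(s)>0$; for the $f$ considered it is known to continue meromorphically to $\mathrm{Re}(s)>-1/a$. Put $$m_0(f,\varphi):=\sup\{\rho>0: Z_f(\varphi)\text{ can be meromorphically continued to a domain containing } \mathrm{Re}(s)>-\rho\},$$ $$m_0(f):=\inf\{m_0(f,\varphi):\varphi\in C_0^\infty(U)\}.$$ *)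

theory Defs
  imports "HOL-Analysis.Analysis" "HOL-Complex_Analysis.Complex_Analysis"
begin

text \<open>
  The case split gives the exponential factor its limit value \<open>0\<close> at \<open>y = 0\<close>; without it,
  division by zero would yield \<open>exp 0 = 1\<close> there. In the theorem \<open>q \<le> a\<close>, so \<open>a - q\<close> is not
  truncated.
\<close>

definition flat_exp :: "real \<Rightarrow> real \<Rightarrow> real" where
  "flat_exp p y = (if y = 0 then 0 else exp (- 1 / \<bar>y\<bar> powr p))"

definition f_flat :: "nat \<Rightarrow> nat \<Rightarrow> real \<Rightarrow> nat \<Rightarrow> real \<times> real \<Rightarrow> real" where
  "f_flat a b p q = (\<lambda>(x, y). x ^ a * y ^ b + x ^ (a - q) * y ^ b * flat_exp p y)"

primrec Ck :: "nat \<Rightarrow> ('a::real_normed_vector \<Rightarrow> 'b::real_normed_vector) \<Rightarrow> bool" where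
  "Ck 0 \<phi> \<longleftrightarrow> continuous_on UNIV \<phi>"
| "Ck (Suc k) \<phi> \<longleftrightarrow> (\<forall>z. \<phi> differentiable (at z)) \<and> (\<forall>v. Ck k (\<lambda>z. frechet_derivative \<phi> (at z) v))"

definition smooth :: "('a::real_normed_vector \<Rightarrow> 'b::real_normed_vector) \<Rightarrow> bool" where
  "smooth \<phi> \<longleftrightarrow> (\<forall>k. Ck k \<phi>)"

definition test_functions :: "(real \<times> real) set \<Rightarrow> (real \<times> real \<Rightarrow> complex) set" where
  "test_functions U =
    {\<phi>. smooth \<phi> \<and> compact (closure {z. \<phi> z \<noteq> 0}) \<and> closure {z. \<phi> z \<noteq> 0} \<subseteq> U}"

text \<open>Used only for \<open>Re s > 0\<close>; there \<open>0 powr s = 0\<close> is the correct value on the zero set of \<open>f\<close>.\<close>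

definition local_zeta ::
  "(real \<times> real \<Rightarrow> real) \<Rightarrow> (real \<times> real \<Rightarrow> complex) \<Rightarrow> complex \<Rightarrow> complex" where
  "local_zeta f \<phi> s = (LINT z|lborel. complex_of_real \<bar>f z\<bar> powr s * \<phi> z)"

text \<open>
  Meromorphic continuation from the half-plane \<open>Re s > 0\<close> to an open set \<open>D\<close> containing it. The
  library's \<open>meromorphic_on\<close> allows arbitrary values at isolated points, so exact agreement on the
  half-plane is the same as agreement off a discrete set.
\<close>

definition zeta_continuable ::
  "(real \<times> real \<Rightarrow> real) \<Rightarrow> (real \<times> real \<Rightarrow> complex) \<Rightarrow> complex set \<Rightarrow> bool" where
  "zeta_continuable f \<phi> D \<longleftrightarrow>
    (\<exists>F. F meromorphic_on D \<and> (\<forall>s. Re s > 0 \<longrightarrow> F s = local_zeta f \<phi> s))"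

text \<open>The supremum may be infinite (e.g. for \<open>\<phi> = 0\<close>), hence extended reals.\<close>

definition m0_at :: "(real \<times> real \<Rightarrow> real) \<Rightarrow> (real \<times> real \<Rightarrow> complex) \<Rightarrow> ereal" where
  "m0_at f \<phi> = Sup (ereal ` {\<rho>. \<rho> > 0 \<and>
     (\<exists>D. open D \<and> connected D \<and> {s. Re s > - \<rho>} \<subseteq> D \<and> zeta_continuable f \<phi> D)})"

definition m0 :: "(real \<times> real \<Rightarrow> real) \<Rightarrow> (real \<times> real) set \<Rightarrow> ereal" where
  "m0 f U = Inf (m0_at f ` test_functions U)"

end

theory Submission
  imports Defs
begin

text \<open>
  Write \<open>e(y) = exp (-1/|y|^p)\<close>, so that \<open>|f| = |x|^(a-q) |y|^b (|x|^q + e(y))\<close>. Both \<open>|f|\<close> and Lebesgue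
  measure are symmetric under reflection in the axes, so \<open>Z\<close> is an integral over the quadrant
  \<open>x, y > 0\<close> with \<open>\<phi>\<close> replaced by the sum \<open>\<psi>\<close> of its four reflections; there
  \<open>f = P (1 + w)\<close> with the leading monomial \<open>P = x^a y^b\<close> and \<open>w = e(y) / x^q\<close>. The assumption that
  \<open>(b/a - 1)/p\<close> is no integer rules out \<open>a = b\<close>, and any \<open>U\<close> inside the unit ball is small enough.

  \<^bold>\<open>Continuation.\<close> Split \<open>f^s \<psi> = P^s T + P^s (\<psi> - T) + P^s ((1+w)^s - 1) \<psi>\<close>, where \<open>T\<close> is the Taylor
  polynomial of \<open>\<psi>\<close> in \<open>y\<close> of degree below \<open>b\<close>. The first term integrates to
  \<open>\<Sum>k<b. C\<^sub>k(s) / (b s + k + 1)\<close> with \<open>C\<^sub>k\<close> holomorphic for \<open>Re s > -1/a\<close>; the second converges there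
  because the remainder is \<open>O(y^b)\<close>; and the third converges there because, for \<open>Re s \<le> 0\<close> and
  \<open>0 < \<epsilon> \<le> 1\<close>, \<open>|(1+w)^s - 1| = O(w^\<epsilon>)\<close>, and \<open>e(y)^\<epsilon>\<close> beats every power of \<open>y\<close>
  (\<open>flat_part_dominated\<close>, \<open>continued_zeta_meromorphic\<close>, \<open>continued_zeta_eq\<close>).

  \<^bold>\<open>Obstruction.\<close> Let \<open>s = (\<tau> - 1)/a\<close> with \<open>\<tau>\<close> tending to \<open>0\<close> from above, and put \<open>\<kappa> = (b/a - 1)/p\<close>. In the
  variables \<open>x = u^(1/\<tau>)\<close>, \<open>y = \<tau>^(1/p) v\<close> the quantity \<open>w\<close> becomes \<open>R^(1/\<tau>)\<close> with
  \<open>R = exp (-v^(-p)) / u^q\<close> independent of \<open>\<tau>\<close>, so \<open>(1+w)^s - 1\<close> tends to \<open>-1\<close> where \<open>R > 1\<close> and to \<open>0\<close>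
  where \<open>R < 1\<close>. Collecting the powers of \<open>\<tau>\<close> and applying dominated convergence shows that
  \<open>\<tau>^(1+\<kappa>)\<close> times the third term tends to a nonzero multiple of \<open>\<psi>(0,0) = 4 \<phi>(0,0)\<close>
  (\<open>flat_part_asymptotics\<close>). The other two terms are smaller: \<open>C\<^sub>k\<close> and the remainder integral are
  \<open>O(1/\<tau>)\<close>, and \<open>b s + k + 1\<close> vanishes at \<open>s = -1/a\<close> only when \<open>k + 1 = b/a\<close>; as \<open>C\<^sub>k = 0\<close> for odd \<open>k\<close>,
  that requires \<open>b/a\<close> to be an odd integer, in which case \<open>\<kappa> > 1\<close> is assumed and \<open>O(1/\<tau>^2)\<close> is still
  negligible (\<open>polar_term_negligible\<close>). Hence \<open>|Z(s)|\<close> grows exactly like \<open>\<tau>^(-1-\<kappa>)\<close>, whereas a function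
  meromorphic at \<open>-1/a\<close> behaves like an integer power (\<open>meromorphic_integer_exponent\<close>).

  For \<open>m\<^sub>0(f)\<close> one needs in addition a test function that does not vanish at the origin
  (\<open>exists_bump\<close>).
\<close>

section \<open>Integrals depending on a complex parameter, and meromorphic growth\<close>

text \<open>
  Differentiation under the integral sign. A bound on \<open>h\<close> that is uniform in \<open>s\<close> bounds the complex
  derivative as well, by Cauchy's inequality, so the difference quotients are dominated.
\<close>

lemma holomorphic_on_lebesgue_integral:
  fixes h :: "complex \<Rightarrow> 'a \<Rightarrow> complex"
  assumes A: "open A"
    and hol: "\<And>z. z \<in> space M \<Longrightarrow> (\<lambda>s. h s z) holomorphic_on A"
    and meas: "\<And>s. s \<in> A \<Longrightarrow> h s \<in> borel_measurable M"
    and dom: "\<And>s0. s0 \<in> A \<Longrightarrow> \<exists>r>0. \<exists>g. integrable M g \<and>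
                (\<forall>s\<in>ball s0 r \<inter> A. \<forall>z\<in>space M. norm (h s z) \<le> g z)"
  shows "(\<lambda>s. \<integral>z. h s z \<partial>M) holomorphic_on A"
proof -
  have "(\<lambda>s. \<integral>z. h s z \<partial>M) field_differentiable (at s0 within A)" if s0A: "s0 \<in> A" for s0
  proof -
    obtain r0 g where r0: "r0 > 0" and g: "integrable M g"
      and gb: "\<And>s z. s \<in> ball s0 r0 \<inter> A \<Longrightarrow> z \<in> space M \<Longrightarrow> norm (h s z) \<le> g z"
      using dom[OF s0A] by blast
    obtain r1 where r1: "r1 > 0" "ball s0 r1 \<subseteq> A"
      using A s0A openE by blast
    \<comment> \<open>The factor 3 leaves room for circles of radius \<open>r\<close> around the points of \<open>ball s0 r\<close>.\<close>
    define r where "r = min r0 r1 / 3"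
    have r: "r > 0" using r0 r1 by (simp add: r_def)
    have inA: "ball s0 (3*r) \<subseteq> A" and inB: "ball s0 (3*r) \<subseteq> ball s0 r0 \<inter> A"
      using r1 by (auto simp: r_def)
    have intb: "integrable M (h s)" if "s \<in> ball s0 (3*r)" for s
      by (rule Bochner_Integration.integrable_bound[OF g])
         (use that inB meas gb in \<open>auto intro!: AE_I2 order_trans[OF gb] simp: subset_eq\<close>)
    have der: "norm (deriv (\<lambda>s. h s z) w) \<le> g z / r" if z: "z \<in> space M" and w: "w \<in> ball s0 r" for z w
    proof -
      have sub: "cball w r \<subseteq> ball s0 (3*r)"
      proof
        fix u assume "u \<in> cball w r"
        then have "dist s0 u \<le> dist s0 w + r" "dist s0 w < r"
          using w dist_triangle[of s0 u w] by auto
        then show "u \<in> ball s0 (3*r)" using r by simp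
      qed
      have "norm ((deriv ^^ 1) (\<lambda>s. h s z) w) \<le> fact 1 * g z / r ^ 1"
      proof (rule Cauchy_inequality)
        show "(\<lambda>s. h s z) holomorphic_on ball w r"
          using holomorphic_on_subset[OF hol[OF z]] sub inA by (meson ball_subset_cball order_trans)
        show "continuous_on (cball w r) (\<lambda>s. h s z)"
          using holomorphic_on_imp_continuous_on[OF hol[OF z]] sub inA continuous_on_subset by blast
        show "norm (h x z) \<le> g z" if "norm (w - x) = r" for x
        proof (rule gb[OF _ z])
          have "x \<in> cball w r" using that by (simp add: dist_norm)
          then show "x \<in> ball s0 r0 \<inter> A" using sub inB by blast
        qed
      qed (use r in auto)
      then show ?thesis by simp
    qed
    have lip: "norm (h s z - h s0 z) \<le> g z / r * norm (s - s0)"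
      if z: "z \<in> space M" and s: "s \<in> ball s0 r" for s z
    proof (rule field_differentiable_bound[of "ball s0 r" "\<lambda>s. h s z" "deriv (\<lambda>s. h s z)"])
      show "((\<lambda>s. h s z) has_field_derivative deriv (\<lambda>s. h s z) x) (at x within ball s0 r)"
        if "x \<in> ball s0 r" for x
      proof -
        have "x \<in> A" using that inA r by (auto simp: subset_eq)
        then show ?thesis
          using holomorphic_derivI[OF hol[OF z] A] by (auto intro: has_field_derivative_at_within)
      qed
    qed (use der z s r in auto)
    define D where "D = (\<integral>z. deriv (\<lambda>s. h s z) s0 \<partial>M)"
    have "((\<lambda>s. \<integral>z. h s z \<partial>M) has_field_derivative D) (at s0 within ball s0 r)"
      unfolding has_field_derivative_iff tendsto_at_iff_sequentially
    proof (intro allI impI)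
      fix X assume X: "\<forall>i. X i \<in> ball s0 r - {s0}" "X \<longlonglongrightarrow> s0"
      have Xb: "X i \<in> ball s0 (3*r)" "X i \<in> ball s0 r" "X i \<noteq> s0" for i
      proof -
        have "X i \<in> ball s0 r - {s0}" using X(1) by blast
        then show "X i \<in> ball s0 (3*r)" "X i \<in> ball s0 r" "X i \<noteq> s0" using r by auto
      qed
      have s03: "s0 \<in> ball s0 (3*r)" using r by simp
      have Xt: "filterlim X (at s0) sequentially"
        using X Xb by (auto simp: filterlim_at)
      have lim: "(\<lambda>i. (h (X i) z - h s0 z) / (X i - s0)) \<longlonglongrightarrow> deriv (\<lambda>s. h s z) s0"
        if z: "z \<in> space M" for z
      proof -
        have "((\<lambda>s. h s z) has_field_derivative deriv (\<lambda>s. h s z) s0) (at s0)"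
          using holomorphic_derivI[OF hol[OF z] A \<open>s0 \<in> A\<close>] by auto
        then show ?thesis
          unfolding has_field_derivative_iff using filterlim_compose Xt by blast
      qed
      have m1: "(\<lambda>z. (h (X i) z - h s0 z) / (X i - s0)) \<in> borel_measurable M" for i
        using intb[OF Xb(1)] intb[OF s03] by (intro borel_measurable_divide borel_measurable_diff borel_measurable_const) auto
      have "(\<lambda>i. \<integral>z. (h (X i) z - h s0 z) / (X i - s0) \<partial>M) \<longlonglongrightarrow> D"
        unfolding D_def
      proof (rule integral_dominated_convergence)
        show "integrable M (\<lambda>z. g z / r)" using g by simp
        show "(\<lambda>z. deriv (\<lambda>s. h s z) s0) \<in> borel_measurable M"
          by (rule borel_measurable_LIMSEQ_metric[OF m1 lim])
        show "AE z in M. norm ((h (X i) z - h s0 z) / (X i - s0)) \<le> g z / r" for i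
        proof (rule AE_I2)
          fix z assume z: "z \<in> space M"
          have "norm (X i - s0) > 0" using Xb(3) by simp
          then show "norm ((h (X i) z - h s0 z) / (X i - s0)) \<le> g z / r"
            unfolding norm_divide using lip[OF z Xb(2)] by (subst pos_divide_le_eq) auto
        qed
      qed (use lim m1 in auto)
      moreover have "(\<integral>z. (h (X i) z - h s0 z) / (X i - s0) \<partial>M)
          = ((\<integral>z. h (X i) z \<partial>M) - (\<integral>z. h s0 z \<partial>M)) / (X i - s0)" for i
        using intb[OF Xb(1)] intb[OF s03] by simp
      ultimately show "((\<lambda>y. ((\<integral>z. h y z \<partial>M) - (\<integral>z. h s0 z \<partial>M)) / (y - s0)) \<circ> X) \<longlonglongrightarrow> D"
        by (simp only: o_def)
    qed
    then have "((\<lambda>s. \<integral>z. h s z \<partial>M) has_field_derivative D) (at s0)"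
      using r by (simp add: at_within_open[of s0 "ball s0 r"])
    then show ?thesis
      using field_differentiable_def has_field_derivative_at_within by blast
  qed
  then show ?thesis by (simp add: holomorphic_on_def)
qed

lemma has_bochner_integral_product:
  fixes f g :: "real \<Rightarrow> 'a :: {real_normed_field, banach, second_countable_topology}"
  assumes f: "integrable lborel f" and g: "integrable lborel g"
  shows "has_bochner_integral lborel (\<lambda>z. f (fst z) * g (snd z)) (integral\<^sup>L lborel f * integral\<^sup>L lborel g)"
proof -
  have [measurable]: "f \<in> borel_measurable borel" "g \<in> borel_measurable borel"
    using f g by auto
  have i: "integrable (lborel \<Otimes>\<^sub>M lborel) (\<lambda>z. f (fst z) * g (snd z))"
    by (rule lborel_pair.Fubini_integrable)
       (use f g in \<open>auto simp: norm_mult\<close>)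
  have "integral\<^sup>L (lborel \<Otimes>\<^sub>M lborel) (\<lambda>z. f (fst z) * g (snd z)) = (\<integral>x. \<integral>y. f x * g y \<partial>lborel \<partial>lborel)"
    using lborel_pair.integral_fst'[OF i] by simp
  also have "\<dots> = integral\<^sup>L lborel f * integral\<^sup>L lborel g"
    by simp
  finally show ?thesis
    using i by (simp add: has_bochner_integral_iff lborel_prod)
qed

lemma has_bochner_integral_powr_unit:
  fixes c :: real
  assumes "c > -1"
  shows "has_bochner_integral lborel (\<lambda>x. indicator {0<..<1} x * x powr c) (1 / (c + 1))"
proof -
  have "((\<lambda>x. x powr c) has_integral (1 powr (c+1) / (c+1))) {0..1}"
    by (rule has_integral_powr_from_0) (use assms in auto)
  then have 1: "((\<lambda>x. x powr c) has_integral (1 / (c+1))) {0<..<1}"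
    by (simp add: has_integral_Icc_iff_Ioo)
  then have "((\<lambda>x. x powr c) absolutely_integrable_on {0<..<1})"
    by (intro nonnegative_absolutely_integrable_1) auto
  then have 2: "set_integrable lborel {0<..<1} (\<lambda>x. x powr c)"
    unfolding set_integrable_def by (subst (asm) integrable_completion) auto
  have "(LINT x:{0<..<1}|lborel. x powr c) = 1 / (c+1)"
    using set_borel_integral_eq_integral(2)[OF 2] 1 by (simp add: integral_unique)
  with 2 show ?thesis
    by (simp add: has_bochner_integral_iff set_integrable_def set_lebesgue_integral_def)
qed

lemma norm_of_real_powr:
  "x > 0 \<Longrightarrow> norm (complex_of_real x powr s) = x powr Re s"
  by (simp add: norm_powr_real_powr)

text \<open>
  The case \<open>Re w > 0\<close> suffices, because the identity of the two sides of the decomposition of the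
  zeta function is only checked where the original integral converges; there the antiderivative
  is continuous up to \<open>0\<close>.
\<close>

lemma has_bochner_integral_complex_powr_unit:
  fixes w :: complex
  assumes "Re w > 0"
  shows "has_bochner_integral lborel (\<lambda>y. indicator {0<..<1} y *\<^sub>R complex_of_real y powr w) (1 / (w + 1))"
proof -
  have w1: "w + 1 \<noteq> 0" using assms by (auto simp: complex_eq_iff)
  have int: "((\<lambda>y. complex_of_real y powr w) has_integral (of_real 1 powr (w+1) / (w+1) - of_real 0 powr (w+1) / (w+1))) {0..1}"
  proof (rule fundamental_theorem_of_calculus_interior)
    show "continuous_on {0..1} (\<lambda>x. complex_of_real x powr (w + 1) / (w + 1))"
      using assms w1 by (intro continuous_intros continuous_on_powr_complex) auto
    fix y :: real assume y: "y \<in> {0<..<1}"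
    have "((\<lambda>x. x powr (w + 1) / (w + 1)) has_field_derivative of_real y powr w) (at (complex_of_real y))"
      using y w1 by (auto intro!: derivative_eq_intros simp: complex_nonpos_Reals_iff)
    then show "((\<lambda>x. complex_of_real x powr (w + 1) / (w + 1)) has_vector_derivative complex_of_real y powr w) (at y)"
      by (rule has_vector_derivative_real_field)
  qed simp
  have m: "set_borel_measurable borel {0<..<1} (\<lambda>y. complex_of_real y powr w)"
    unfolding set_borel_measurable_def
    by (rule borel_measurable_continuous_on_indicator)
       (auto intro!: continuous_intros simp: complex_nonpos_Reals_iff)
  have 2: "set_integrable lborel {0<..<1} (\<lambda>y. complex_of_real y powr w)"
    unfolding set_integrable_def
  proof (rule Bochner_Integration.integrable_bound)
    show "integrable lborel (\<lambda>x. indicator {0<..<1} x * x powr Re w)"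
      using has_bochner_integral_powr_unit[of "Re w"] assms by (auto simp: has_bochner_integral_iff)
  qed (use m in \<open>auto simp: set_borel_measurable_def norm_of_real_powr indicator_def\<close>)
  have "(LINT y:{0<..<1}|lborel. complex_of_real y powr w) = 1 / (w+1)"
    using set_borel_integral_eq_integral(2)[OF 2] int
    by (simp add: has_integral_Icc_iff_Ioo integral_unique)
  with 2 show ?thesis
    by (simp add: has_bochner_integral_iff set_integrable_def set_lebesgue_integral_def)
qed

text \<open>
  From \<open>ln (d t) \<le> d t - 1\<close> with \<open>d = e/m\<close>.
\<close>

lemma powr_mult_exp_minus_bounded:
  fixes m e :: real
  assumes "e > 0" "m \<ge> 0"
  shows "\<exists>C\<ge>0. \<forall>t>0. t powr m * exp (- e * t) \<le> C"
proof (cases "m = 0")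
  case True then show ?thesis using assms by (intro exI[of _ 1]) auto
next
  case False
  then have m: "m > 0" using assms by simp
  define d where "d = e / m"
  have d: "d > 0" using assms m by (simp add: d_def)
  show ?thesis
  proof (intro exI[of _ "exp (- m * ln d)"] conjI allI impI)
    fix t :: real assume t: "t > 0"
    have "ln (d * t) \<le> d * t - 1" using d t by (intro ln_le_minus_one) auto
    then have "ln t \<le> d * t - ln d" using d t by (simp add: ln_mult)
    then have "m * ln t \<le> m * (d * t - ln d)" using m by (intro mult_left_mono) auto
    then have "m * ln t - e * t \<le> - m * ln d" using m by (simp add: d_def algebra_simps)
    moreover have "t powr m * exp (- e * t) = exp (m * ln t - e * t)"
      using t by (simp add: powr_def exp_diff exp_minus field_simps)
    ultimately show "t powr m * exp (- e * t) \<le> exp (- m * ln d)" by simp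
  qed auto
qed

text \<open>
  The flat factor \<open>exp (-e y^(-p))\<close> beats every negative power of \<open>y\<close>: put \<open>t = y^(-p)\<close>, so that
  exponential decay in \<open>t\<close> is compared with a power of \<open>t\<close>.
\<close>

lemma powr_mult_flat_bounded:
  fixes p e c :: real
  assumes "p > 0" "e > 0" "c \<ge> 0"
  shows "\<exists>C\<ge>0. \<forall>y>0. y powr (-c) * exp (- e * y powr (-p)) \<le> C"
proof -
  obtain C where C: "C \<ge> 0" "\<And>t. t > 0 \<Longrightarrow> t powr (c/p) * exp (- e * t) \<le> C"
    using powr_mult_exp_minus_bounded[of e "c/p"] assms by auto
  show ?thesis
  proof (intro exI[of _ C] conjI allI impI)
    fix y :: real assume "y > 0"
    then show "y powr (-c) * exp (- e * y powr (-p)) \<le> C"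
      using C(2)[of "y powr (-p)"] assms by (simp add: powr_powr)
  qed (use C in auto)
qed

text \<open>
  Near a point a meromorphic function is comparable to \<open>|s - s0|^N\<close> with \<open>N\<close> an integer, so a
  nonzero limit along one sequence already forces the compensating exponent to be \<open>-N\<close>.
\<close>

lemma meromorphic_integer_exponent:
  fixes F :: "complex \<Rightarrow> complex" and e l :: real
  assumes F: "F meromorphic_on {s0}" and s: "s \<longlonglongrightarrow> s0" "\<And>n. s n \<noteq> s0"
    and lim: "(\<lambda>n. norm (s n - s0) powr e * norm (F (s n))) \<longlonglongrightarrow> l" and l: "l \<noteq> 0"
  shows "e \<in> \<int>"
proof -
  have iso: "isolated_singularity_at F s0" "not_essential F s0"
    using F by (auto simp: meromorphic_at_iff)
  have at: "filterlim s (at s0) sequentially"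
    using s by (auto simp: filterlim_at)
  have freq: "\<exists>\<^sub>F w in at s0. F w \<noteq> 0"
  proof (rule ccontr)
    assume "\<not> ?thesis"
    then have "\<forall>\<^sub>F w in at s0. F w = 0" by (simp add: frequently_def)
    then have "\<forall>\<^sub>F n in sequentially. F (s n) = 0" using at by (rule eventually_compose_filterlim)
    then have "\<forall>\<^sub>F n in sequentially. norm (s n - s0) powr e * norm (F (s n)) = 0"
      by eventually_elim simp
    then have "(\<lambda>n. norm (s n - s0) powr e * norm (F (s n))) \<longlonglongrightarrow> 0" by (rule tendsto_eventually)
    then show False using LIMSEQ_unique lim l by blast
  qed
  define N where "N = zorder F s0"
  define g where "g = zor_poly F s0"
  obtain r where r: "r > 0" and g0: "g s0 \<noteq> 0" and gh: "g holomorphic_on cball s0 r"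
    and Fg: "\<And>w. w \<in> cball s0 r - {s0} \<Longrightarrow> F w = g w * (w - s0) powi N"
    using zorder_exist[OF iso freq] unfolding N_def g_def by blast
  have gc: "isCont g s0"
    using holomorphic_on_imp_continuous_on[OF gh] r by (simp add: continuous_on_interior)
  define d where "d n = norm (s n - s0)" for n
  have d: "d n > 0" for n using s(2)[of n] by (simp add: d_def)
  have d0: "d \<longlonglongrightarrow> 0" using s(1) unfolding d_def by (simp add: LIM_zero_iff tendsto_norm_zero_iff)
  have glim: "(\<lambda>n. norm (g (s n))) \<longlonglongrightarrow> norm (g s0)"
    using isCont_tendsto_compose[OF gc s(1)] by (rule tendsto_norm)
  have "\<forall>\<^sub>F n in sequentially. d n < r" using d0 r by (simp add: order_tendsto_iff)
  then have "\<forall>\<^sub>F n in sequentially. d n powr e * norm (F (s n)) = d n powr (e + of_int N) * norm (g (s n))"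
  proof eventually_elim
    case (elim n)
    then have "F (s n) = g (s n) * (s n - s0) powi N"
      using s(2)[of n] by (intro Fg) (auto simp: d_def dist_norm norm_minus_commute)
    then have "norm (F (s n)) = norm (g (s n)) * d n powi N" by (simp add: norm_mult norm_power_int d_def)
    also have "d n powi N = d n powr of_int N" using d[of n] by (simp add: powr_real_of_int')
    finally show ?case by (simp add: powr_add)
  qed
  then have "(\<lambda>n. d n powr (e + of_int N) * norm (g (s n))) \<longlonglongrightarrow> l"
    using lim unfolding d_def[symmetric] by (simp add: tendsto_cong)
  then have "(\<lambda>n. d n powr (e + of_int N) * norm (g (s n)) / norm (g (s n))) \<longlonglongrightarrow> l / norm (g s0)"
    using glim g0 by (intro tendsto_divide) auto
  moreover have "\<forall>\<^sub>F n in sequentially. norm (g (s n)) \<noteq> 0"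
    using tendsto_imp_eventually_ne[OF glim, of 0] g0 by simp
  then have "\<forall>\<^sub>F n in sequentially. d n powr (e + of_int N) * norm (g (s n)) / norm (g (s n)) = d n powr (e + of_int N)"
    by eventually_elim simp
  ultimately have plim: "(\<lambda>n. d n powr (e + of_int N)) \<longlonglongrightarrow> l / norm (g s0)"
    by (simp add: tendsto_cong)
  have nz: "l / norm (g s0) \<noteq> 0" using l g0 by simp
  have z: "(\<lambda>n. d n powr y) \<longlonglongrightarrow> 0" if "y > 0" for y
  proof -
    have "(\<lambda>n. d n powr y) \<longlonglongrightarrow> 0 powr y"
      by (intro tendsto_powr2 d0 tendsto_const always_eventually allI less_imp_le[OF d] that)
    then show ?thesis by simp
  qed
  have "e + of_int N = 0"
  proof (rule ccontr)
    assume "e + of_int N \<noteq> 0"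
    then consider "e + of_int N > 0" | "- (e + of_int N) > 0" by linarith
    then show False
    proof cases
      case 1
      then show False using LIMSEQ_unique[OF plim z] nz by blast
    next
      case 2
      have "(\<lambda>n. inverse (d n powr (e + of_int N))) \<longlonglongrightarrow> inverse (l / norm (g s0))"
        using plim nz by (rule tendsto_inverse)
      then have "(\<lambda>n. d n powr (- (e + of_int N))) \<longlonglongrightarrow> inverse (l / norm (g s0))"
        by (simp only: powr_minus)
      then have "inverse (l / norm (g s0)) = 0" using z[OF 2] LIMSEQ_unique by blast
      then show False using nz by simp
    qed
  qed
  then have "e = of_int (- N)" by simp
  then show ?thesis by (metis Ints_of_int)
qed

lemma norm_lebesgue_integral_le:
  fixes f :: "'a \<Rightarrow> complex"
  assumes "integrable N f" "integrable N g" "\<And>x. norm (f x) \<le> g x"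
  shows "norm (\<integral>x. f x \<partial>N) \<le> (\<integral>x. g x \<partial>N)"
  using assms by (intro order_trans[OF integral_norm_bound] integral_mono) auto

section \<open>A power substitution on the quadrant\<close>

abbreviation quadrant :: "(real \<times> real) set" where
  "quadrant \<equiv> {0<..} \<times> {0<..}"

text \<open>
  The substitution \<open>x = k u^e\<close> on the half line, by exhausting it with the compact intervals
  \<open>[1/(n+2), n+2]\<close>. One lemma serves both coordinates: \<open>k = 1\<close> gives the pure power, \<open>e = 1\<close> the pure
  dilation.
\<close>

lemma nn_integral_power_substitution:
  fixes f :: "real \<Rightarrow> ennreal"
  assumes [measurable]: "f \<in> borel_measurable borel" and e: "e > 0" and k: "k > 0"
  shows "(\<integral>\<^sup>+x. f x * indicator {0<..} x \<partial>lborel)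
       = (\<integral>\<^sup>+u. f (k * u powr e) * ennreal (k * e * u powr (e - 1)) * indicator {0<..} u \<partial>lborel)"
proof -
  define g where "g u = k * u powr e" for u
  define l where "l n = 1 / (real n + 2)" for n
  define h where "h n = real n + 2" for n
  have l: "0 < l n" "l n < h n" for n
  proof -
    show "0 < l n" by (simp add: l_def)
    have "l n \<le> 1" by (simp add: l_def)
    then show "l n < h n" by (simp add: h_def)
  qed
  have mono: "l (Suc n) \<le> l n" "h n \<le> h (Suc n)" for n
    by (auto simp: l_def h_def field_simps)
  have gmono: "g x \<le> g y" if "0 \<le> x" "x \<le> y" for x y
    using that e k by (auto simp: g_def intro!: mult_left_mono powr_mono2)
  have l0: "l \<longlonglongrightarrow> 0" unfolding l_def by real_asymp
  have hinf: "filterlim h at_top sequentially" unfolding h_def by real_asymp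
  have sub: "(\<integral>\<^sup>+x. f x * indicator {g (l n)..g (h n)} x \<partial>lborel)
      = (\<integral>\<^sup>+u. f (g u) * ennreal (k * e * u powr (e - 1)) * indicator {l n..h n} u \<partial>lborel)" for n
  proof (rule nn_integral_substitution_aux)
    fix x assume "x \<in> {l n..h n}"
    then have "x > 0" using l[of n] by auto
    then show "(g has_real_derivative k * e * x powr (e - 1)) (at x)"
      unfolding g_def by (auto intro!: derivative_eq_intros)
  qed (use l[of n] e k in \<open>auto intro!: continuous_intros\<close>)
  have 1: "(\<lambda>n. \<integral>\<^sup>+x. f x * indicator {g (l n)..g (h n)} x \<partial>lborel)
     \<longlonglongrightarrow> (\<integral>\<^sup>+x. f x * indicator {0<..} x \<partial>lborel)"
  proof (rule nn_integral_LIMSEQ)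
    have gm: "g (l (Suc n)) \<le> g (l n)" "g (h n) \<le> g (h (Suc n))" for n
      using gmono[of "l (Suc n)" "l n"] gmono[of "h n" "h (Suc n)"] l[of n] l[of "Suc n"] mono[of n]
      by auto
    show "incseq (\<lambda>n x. f x * indicator {g (l n)..g (h n)} x)"
      by (intro incseq_SucI le_funI mult_left_mono)
         (auto simp: indicator_def intro: order_trans[OF gm(1)] order_trans[OF _ gm(2)])
    show "(\<lambda>n. f x * indicator {g (l n)..g (h n)} x) \<longlonglongrightarrow> f x * indicator {0<..} x" for x
    proof (cases "x > 0")
      case True
      have "(\<lambda>n. g (l n)) \<longlonglongrightarrow> 0"
        unfolding g_def l_def using e by real_asymp
      then have "\<forall>\<^sub>F n in sequentially. g (l n) < x" using True by (simp add: order_tendsto_iff)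
      moreover have "filterlim (\<lambda>n. g (h n)) at_top sequentially"
        unfolding g_def h_def using e k by real_asymp
      then have "\<forall>\<^sub>F n in sequentially. g (h n) \<ge> x" by (simp add: filterlim_at_top)
      ultimately have "\<forall>\<^sub>F n in sequentially. f x * indicator {g (l n)..g (h n)} x = f x * indicator {0<..} x"
        by eventually_elim (use True in auto)
      then show ?thesis by (rule tendsto_eventually)
    next
      case False
      have "x \<notin> {g (l n)..g (h n)}" for n
      proof -
        have "g (l n) > 0" using l[of n] k by (simp add: g_def)
        then show ?thesis using False by auto
      qed
      then show ?thesis using False by simp
    qed
  qed simp
  have 2: "(\<lambda>n. \<integral>\<^sup>+u. f (g u) * ennreal (k * e * u powr (e - 1)) * indicator {l n..h n} u \<partial>lborel)
     \<longlonglongrightarrow> (\<integral>\<^sup>+u. f (g u) * ennreal (k * e * u powr (e - 1)) * indicator {0<..} u \<partial>lborel)"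
  proof (rule nn_integral_LIMSEQ)
    show "incseq (\<lambda>n u. f (g u) * ennreal (k * e * u powr (e - 1)) * indicator {l n..h n} u)"
      using mono by (intro incseq_SucI le_funI mult_left_mono) (auto simp: indicator_def intro: order_trans)
    show "(\<lambda>n. f (g u) * ennreal (k * e * u powr (e - 1)) * indicator {l n..h n} u)
        \<longlonglongrightarrow> f (g u) * ennreal (k * e * u powr (e - 1)) * indicator {0<..} u" for u
    proof (cases "u > 0")
      case True
      have "\<forall>\<^sub>F n in sequentially. l n < u" using True l0 by (simp add: order_tendsto_iff)
      moreover have "\<forall>\<^sub>F n in sequentially. h n \<ge> u" using hinf by (simp add: filterlim_at_top)
      ultimately have "\<forall>\<^sub>F n in sequentially. f (g u) * ennreal (k * e * u powr (e - 1)) * indicator {l n..h n} u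
          = f (g u) * ennreal (k * e * u powr (e - 1)) * indicator {0<..} u"
        by eventually_elim (use True in auto)
      then show ?thesis by (rule tendsto_eventually)
    next
      case False
      then have "u \<notin> {l n..h n}" for n using l[of n] by auto
      then show ?thesis using False by simp
    qed
  qed (simp add: g_def)
  show ?thesis
    using LIMSEQ_unique[OF 1 2[folded sub]] unfolding g_def .
qed

lemma nn_integral_quadrant_substitution:
  fixes h :: "real \<times> real \<Rightarrow> ennreal"
  assumes h: "h \<in> borel_measurable borel" and e: "d > 0" "e > 0" and k: "k > 0" "l > 0"
  shows "(\<integral>\<^sup>+z. h z * indicator quadrant z \<partial>lborel)
       = (\<integral>\<^sup>+z. h (k * fst z powr d, l * snd z powr e)
            * ennreal (k * d * fst z powr (d - 1) * (l * e * snd z powr (e - 1))) * indicator quadrant z \<partial>lborel)"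
proof -
  note [measurable] = h[unfolded borel_prod[symmetric]]
  have i: "indicator quadrant (x, y) = (indicator {0<..} x * indicator {0<..} y :: ennreal)" for x y :: real
    by (auto simp: indicator_def)
  have "(\<integral>\<^sup>+z. h z * indicator quadrant z \<partial>lborel)
      = (\<integral>\<^sup>+z. h z * indicator quadrant z \<partial>(lborel \<Otimes>\<^sub>M lborel))"
    by (simp add: lborel_prod)
  also have "\<dots> = (\<integral>\<^sup>+x. \<integral>\<^sup>+y. h (x, y) * indicator quadrant (x, y) \<partial>lborel \<partial>lborel)"
    by (intro lborel.nn_integral_fst[symmetric]) measurable
  also have "\<dots> = (\<integral>\<^sup>+x. (\<integral>\<^sup>+y. h (x, y) * indicator {0<..} y \<partial>lborel) * indicator {0<..} x \<partial>lborel)"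
    by (intro nn_integral_cong) (auto simp: i indicator_def)
  also have "\<dots> = (\<integral>\<^sup>+x. (\<integral>\<^sup>+v. h (x, l * v powr e) * ennreal (l * e * v powr (e - 1)) * indicator {0<..} v \<partial>lborel) * indicator {0<..} x \<partial>lborel)"
    using e k by (subst nn_integral_power_substitution[of _ e l]) auto
  also have "\<dots> = (\<integral>\<^sup>+u. (\<integral>\<^sup>+v. h (k * u powr d, l * v powr e) * ennreal (l * e * v powr (e - 1)) * indicator {0<..} v \<partial>lborel)
        * ennreal (k * d * u powr (d - 1)) * indicator {0<..} u \<partial>lborel)"
    using e k by (subst nn_integral_power_substitution[of _ d k]) auto
  also have "\<dots> = (\<integral>\<^sup>+u. \<integral>\<^sup>+v. h (k * u powr d, l * v powr e) * ennreal (k * d * u powr (d - 1) * (l * e * v powr (e - 1)))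
        * indicator quadrant (u, v) \<partial>lborel \<partial>lborel)"
  proof (intro nn_integral_cong)
    fix u :: real
    show "(\<integral>\<^sup>+v. h (k * u powr d, l * v powr e) * ennreal (l * e * v powr (e - 1)) * indicator {0<..} v \<partial>lborel)
        * ennreal (k * d * u powr (d - 1)) * indicator {0<..} u
      = (\<integral>\<^sup>+v. h (k * u powr d, l * v powr e) * ennreal (k * d * u powr (d - 1) * (l * e * v powr (e - 1)))
        * indicator quadrant (u, v) \<partial>lborel)"
      using e k unfolding mult.assoc[of _ "ennreal (k * d * u powr (d - 1))"]
      by (subst nn_integral_multc[symmetric]) (auto intro!: nn_integral_cong simp: i ennreal_mult mult_ac)
  qed
  also have "\<dots> = (\<integral>\<^sup>+z. h (k * fst z powr d, l * snd z powr e)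
            * ennreal (k * d * fst z powr (d - 1) * (l * e * snd z powr (e - 1))) * indicator quadrant z \<partial>(lborel \<Otimes>\<^sub>M lborel))"
    by (subst lborel.nn_integral_fst[symmetric]) (simp_all add: )
  finally show ?thesis by (simp add: lborel_prod)
qed

text \<open>
  The nonnegative version says that restricted Lebesgue measure is the image of a weighted one, and
  this identity of measures carries over to integrals of complex functions.
\<close>

lemma integral_quadrant_substitution:
  fixes h :: "real \<times> real \<Rightarrow> complex"
  assumes h: "h \<in> borel_measurable borel" and e: "d > 0" "e > 0" and k: "k > 0" "l > 0"
  shows "(LINT z|lborel. indicator quadrant z *\<^sub>R h z)
       = (LINT z|lborel. (indicator quadrant z * (k * d * fst z powr (d - 1) * (l * e * snd z powr (e - 1))))
            *\<^sub>R h (k * fst z powr d, l * snd z powr e))"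
proof -
  define T where "T z = (k * fst z powr d, l * snd z powr e)" for z :: "real \<times> real"
  define J where "J z = indicator quadrant z * (k * d * fst z powr (d - 1) * (l * e * snd z powr (e - 1)))" for z :: "real \<times> real"
  have Q: "quadrant \<in> sets borel" by (intro borel_open open_Times) auto
  note [measurable] = Q h
  have [measurable]: "fst \<in> (borel :: (real \<times> real) measure) \<rightarrow>\<^sub>M borel" "snd \<in> (borel :: (real \<times> real) measure) \<rightarrow>\<^sub>M borel"
    by (intro borel_measurable_continuous_onI continuous_intros)+
  have T[measurable]: "T \<in> borel \<rightarrow>\<^sub>M borel" unfolding T_def by measurable
  have J[measurable]: "J \<in> borel_measurable borel" unfolding J_def by measurable
  have J0: "J z \<ge> 0" for z using e k by (auto simp: J_def)
  have eq: "density lborel (indicator quadrant) = distr (density lborel (\<lambda>z. ennreal (J z))) borel T"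
  proof (rule measure_eqI)
    fix A assume "A \<in> sets (density lborel (indicator quadrant))"
    then have A[measurable]: "A \<in> sets borel" by simp
    have "emeasure (density lborel (indicator quadrant)) A = (\<integral>\<^sup>+z. indicator A z * indicator quadrant z \<partial>lborel)"
      by (subst emeasure_density) (auto simp: mult.commute)
    also have "\<dots> = (\<integral>\<^sup>+z. indicator A (k * fst z powr d, l * snd z powr e)
            * ennreal (k * d * fst z powr (d - 1) * (l * e * snd z powr (e - 1))) * indicator quadrant z \<partial>lborel)"
      by (rule nn_integral_quadrant_substitution[OF _ e k]) measurable
    also have "\<dots> = (\<integral>\<^sup>+z. ennreal (J z) * indicator (T -` A) z \<partial>lborel)"
      by (intro nn_integral_cong) (auto simp: J_def T_def indicator_def)
    also have "\<dots> = emeasure (density lborel (\<lambda>z. ennreal (J z))) (T -` A)"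
      using measurable_sets[OF T A] by (subst emeasure_density) auto
    also have "\<dots> = emeasure (distr (density lborel (\<lambda>z. ennreal (J z))) borel T) A"
      by (subst emeasure_distr) auto
    finally show "emeasure (density lborel (indicator quadrant)) A = emeasure (distr (density lborel (\<lambda>z. ennreal (J z))) borel T) A" .
  qed simp
  have "(LINT z|lborel. indicator quadrant z *\<^sub>R h z) = integral\<^sup>L (density lborel (\<lambda>z. ennreal (indicator quadrant z))) h"
    by (subst integral_density) auto
  also have "\<dots> = integral\<^sup>L (density lborel (indicator quadrant)) h"
  proof -
    have "(\<lambda>z. ennreal (indicator quadrant z)) = indicator quadrant"
      by (rule ext) (rule ennreal_indicator)
    then show ?thesis by (rule arg_cong)
  qed
  also have "\<dots> = integral\<^sup>L (density lborel (\<lambda>z. ennreal (J z))) (\<lambda>z. h (T z))"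
    unfolding eq by (rule integral_distr) auto
  also have "\<dots> = (LINT z|lborel. J z *\<^sub>R h (T z))"
    using J0 by (subst integral_density) auto
  finally show ?thesis by (simp add: J_def T_def)
qed

lemma integrable_powr_at_infinity:
  fixes e :: real
  assumes "e > 1"
  shows "integrable lborel (\<lambda>x. indicator {1..} x * x powr (-e))"
proof -
  have "((\<lambda>x. x powr (-e)) has_integral -(1 powr (-e+1)) / (-e+1)) {1..}"
    using assms by (intro has_integral_powr_to_inf) auto
  then have "((\<lambda>x. x powr (-e)) absolutely_integrable_on {1..})"
    by (intro nonnegative_absolutely_integrable_1) auto
  then have "set_integrable lborel {1..} (\<lambda>x. x powr (-e))"
    unfolding set_integrable_def by (subst (asm) integrable_completion) auto
  then show ?thesis by (simp add: set_integrable_def)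
qed

lemma integrable_flat_powr:
  fixes e d p :: real
  assumes e: "e > 1" and d: "d > 0" and p: "p > 0"
  shows "integrable lborel (\<lambda>v. indicator {0<..} v * (v powr (-e) * exp (- d * v powr (-p))))"
proof -
  obtain C where C: "C \<ge> 0" "\<And>v. v > 0 \<Longrightarrow> v powr (-e) * exp (- d * v powr (-p)) \<le> C"
    using powr_mult_flat_bounded[OF p d, of e] e by auto
  show ?thesis
  proof (rule Bochner_Integration.integrable_bound)
    show "integrable lborel (\<lambda>v. C * indicator {0<..<1} v + indicator {1..} v * v powr (-e))"
      using integrable_powr_at_infinity[OF e] by auto
    show "AE v in lborel. norm (indicator {0<..} v * (v powr (-e) * exp (- d * v powr (-p))))
        \<le> norm (C * indicator {0<..<1} v + indicator {1..} v * v powr (-e))"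
    proof (rule AE_I2)
      fix v :: real
      consider "v \<le> 0" | "0 < v" "v < 1" | "1 \<le> v" by linarith
      then show "norm (indicator {0<..} v * (v powr (-e) * exp (- d * v powr (-p))))
        \<le> norm (C * indicator {0<..<1} v + indicator {1..} v * v powr (-e))"
      proof cases
        case 3
        then have "v powr (-e) * exp (- d * v powr (-p)) \<le> v powr (-e) * 1"
          using d by (intro mult_left_mono) auto
        then show ?thesis using 3 by simp
      qed (use C in auto)
    qed
  qed auto
qed

section \<open>The phase and its flat perturbation\<close>

text \<open>
  The strict inequality \<open>a < b\<close> is what makes the exponent \<open>\<kappa>\<close> of the obstruction positive.
\<close>

locale flat_phase =
  fixes a b q :: nat and p :: real
  assumes a2: "2 \<le> a" and ab: "a < b" and p0: "0 < p" and q2: "2 \<le> q" and qa: "q \<le> a"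
begin

text \<open>
  On the open quadrant \<open>f = leading * (1 + ratio)\<close>.
\<close>

definition leading :: "real \<times> real \<Rightarrow> real" where
  "leading z = fst z ^ a * snd z ^ b"

definition ratio :: "real \<times> real \<Rightarrow> real" where
  "ratio z = flat_exp p (snd z) / fst z ^ q"

abbreviation usquare :: "(real \<times> real) set" where
  "usquare \<equiv> {0<..<1} \<times> {0<..<1}"

abbreviation half_plane :: "complex set" where
  "half_plane \<equiv> {s. Re s > - 1 / real a}"

lemma flat_exp_measurable [measurable]: "flat_exp p \<in> borel_measurable borel"
  unfolding flat_exp_def by measurable

lemma fst_borel [measurable]: "fst \<in> (borel :: (real \<times> real) measure) \<rightarrow>\<^sub>M borel"
  by (intro borel_measurable_continuous_onI continuous_intros)

lemma snd_borel [measurable]: "snd \<in> (borel :: (real \<times> real) measure) \<rightarrow>\<^sub>M borel"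
  by (intro borel_measurable_continuous_onI continuous_intros)

lemma leading_measurable [measurable]: "leading \<in> borel_measurable borel"
  unfolding leading_def by measurable

lemma ratio_measurable [measurable]: "ratio \<in> borel_measurable borel"
  unfolding ratio_def by measurable

lemma usquare_measurable [measurable]: "usquare \<in> sets borel"
  by (intro borel_open open_Times) auto

lemma powr_complex_measurable [measurable (raw)]:
  "f \<in> borel_measurable N \<Longrightarrow> (\<lambda>z. (f z :: complex) powr s) \<in> borel_measurable N"
proof -
  assume [measurable]: "f \<in> borel_measurable N"
  have "f -` {0} \<inter> space N \<in> sets N" by measurable
  also have "f -` {0} \<inter> space N = {z \<in> space N. f z = 0}" by auto
  finally have [measurable]: "Measurable.pred N (\<lambda>z. f z = 0)" by (simp add: pred_def)
  show ?thesis unfolding powr_def by measurable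
qed

lemma flat_exp_pos: "y > 0 \<Longrightarrow> flat_exp p y = exp (- (y powr (-p)))"
  by (simp add: flat_exp_def powr_minus field_simps)

lemma leading_pos: "fst z > 0 \<Longrightarrow> snd z > 0 \<Longrightarrow> leading z > 0"
  by (simp add: leading_def)

lemma ratio_pos: "fst z > 0 \<Longrightarrow> snd z > 0 \<Longrightarrow> ratio z > 0"
  by (simp add: ratio_def flat_exp_pos)

lemma leading_le_1: "z \<in> usquare \<Longrightarrow> leading z \<le> 1"
  by (auto simp: leading_def intro!: mult_le_one power_le_one)

lemma f_flat_factor: "fst z > 0 \<Longrightarrow> f_flat a b p q z = leading z * (1 + ratio z)"
  using qa by (cases z) (simp add: f_flat_def leading_def ratio_def field_simps power_diff)

lemma f_flat_le_2: "z \<in> usquare \<Longrightarrow> leading z * (1 + ratio z) \<le> 2"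
proof -
  assume z: "z \<in> usquare"
  have e: "0 \<le> flat_exp p (snd z)" "flat_exp p (snd z) \<le> 1" using z by (auto simp: flat_exp_pos)
  have "fst z ^ (a - q) * snd z ^ b * flat_exp p (snd z) \<le> 1"
    using z e by (intro mult_le_one power_le_one mult_nonneg_nonneg) auto
  moreover have "fst z ^ a * snd z ^ b \<le> 1" using leading_le_1[OF z] by (simp add: leading_def)
  ultimately show ?thesis
    using f_flat_factor[of z] z by (auto simp: f_flat_def)
qed

lemma leading_powr:
  assumes "fst z > 0" "snd z > 0"
  shows "leading z powr t = fst z powr (real a * t) * snd z powr (real b * t)"
proof -
  have "leading z = fst z powr real a * snd z powr real b"
    using assms by (simp add: leading_def powr_realpow)
  then show ?thesis
    using assms by (simp only: powr_mult powr_powr)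
qed

lemma of_real_powr_eq_exp:
  "t > 0 \<Longrightarrow> complex_of_real t powr s = exp (s * of_real (ln t))"
  by (simp add: powr_def Ln_of_real)

lemma leading_powr_complex:
  assumes "x > 0" "y > 0"
  shows "complex_of_real (leading (x, y)) powr s
      = complex_of_real x powr (of_nat a * s) * complex_of_real y powr (of_nat b * s)"
proof -
  have "ln (leading (x, y)) = real a * ln x + real b * ln y"
    using assms by (simp add: leading_def ln_mult ln_realpow)
  then show ?thesis
    using assms leading_pos[of "(x,y)"]
    by (simp add: powr_def Ln_of_real exp_add[symmetric] algebra_simps)
qed

text \<open>
  Near a point of the half plane the size of \<open>s\<close> is bounded and \<open>Re s\<close> stays above some \<open>t > -1/a\<close>.
  Taking \<open>t \<le> 0\<close> makes \<open>leading^t \<ge> 1\<close> on the unit square, so that bounded quantities can be absorbed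
  into multiples of \<open>leading^t\<close>.
\<close>

lemma half_plane_nbhd:
  assumes "s0 \<in> half_plane"
  shows "\<exists>r>0. \<exists>t B. - 1 / real a < t \<and> t \<le> 0 \<and> 1 \<le> B \<and>
           (\<forall>s\<in>ball s0 r. t \<le> Re s \<and> norm s \<le> B)"
proof -
  define r where "r = (Re s0 + 1 / real a) / 2"
  have r: "r > 0" using assms by (simp add: r_def)
  define t where "t = min 0 (Re s0 - r)"
  have t: "- 1 / real a < t" "t \<le> 0"
    using assms a2 by (auto simp: t_def r_def field_simps)
  have "t \<le> Re s \<and> norm s \<le> norm s0 + r + 1" if "s \<in> ball s0 r" for s
  proof -
    have d: "norm (s0 - s) < r" using that by (simp add: dist_norm)
    have "\<bar>Re (s0 - s)\<bar> < r" using d abs_Re_le_cmod[of "s0 - s"] by linarith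
    moreover have "norm s \<le> norm s0 + norm (s0 - s)"
      by (metis norm_minus_commute norm_triangle_sub)
    ultimately show ?thesis using d by (auto simp: t_def)
  qed
  moreover have "1 \<le> norm s0 + r + 1" using r by simp
  ultimately show ?thesis using r t by blast
qed

lemma leading_powr_bound:
  assumes z: "z \<in> usquare" and t: "t \<le> Re s"
  shows "norm (complex_of_real (leading z) powr s) \<le> leading z powr t"
proof -
  have "leading z > 0" using z leading_pos by auto
  then show ?thesis
    using leading_le_1[OF z] t by (simp add: norm_of_real_powr powr_mono')
qed

text \<open>
  Where \<open>w = ratio z \<ge> 1\<close> both terms are separately \<open>O(leading^t)\<close> and \<open>w^e \<ge> 1\<close>. Where \<open>w < 1\<close> the
  difference is \<open>leading^s (exp (s ln (1+w)) - 1)\<close>, which is \<open>O(leading^t w)\<close>, and \<open>w \<le> w^e\<close>.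
\<close>

lemma flat_difference_bound:
  assumes z: "z \<in> usquare" and t: "- 1 / real a < t" "t \<le> 0" "t \<le> Re s" and B: "1 \<le> B" "norm s \<le> B"
    and e: "0 < e" "e \<le> 1"
  shows "norm (complex_of_real (leading z * (1 + ratio z)) powr s - complex_of_real (leading z) powr s)
           \<le> (exp B * B + 2 powr B + 1) * (leading z powr t * ratio z powr e)"
proof -
  have P: "leading z > 0" and w: "ratio z > 0" using z leading_pos ratio_pos by auto
  have Pt: "leading z powr t \<ge> 1"
    using powr_mono'[of t 0 "leading z"] P leading_le_1[OF z] t by simp
  have nP: "norm (complex_of_real (leading z) powr s) \<le> leading z powr t"
    by (rule leading_powr_bound[OF z t(3)])
  have RB: "Re s \<le> B" using B complex_Re_le_cmod[of s] by linarith
  show ?thesis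
  proof (cases "ratio z \<ge> 1")
    case True
    have f0: "leading z * (1 + ratio z) > 0" using P w by simp
    have "norm (complex_of_real (leading z * (1 + ratio z)) powr s) \<le> 2 powr B * leading z powr t"
    proof (cases "Re s \<ge> 0")
      case True
      have "norm (complex_of_real (leading z * (1 + ratio z)) powr s) = (leading z * (1 + ratio z)) powr Re s"
        using f0 by (rule norm_of_real_powr)
      also have "\<dots> \<le> 2 powr Re s"
        using f0 f_flat_le_2[OF z] True by (intro powr_mono2) auto
      also have "\<dots> \<le> 2 powr B" using RB by (intro powr_mono) auto
      also have "\<dots> \<le> 2 powr B * leading z powr t" using Pt by simp
      finally show ?thesis .
    next
      case False
      have "norm (complex_of_real (leading z * (1 + ratio z)) powr s) = (leading z * (1 + ratio z)) powr Re s"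
        using f0 by (rule norm_of_real_powr)
      also have "\<dots> \<le> leading z powr Re s"
        using P w False by (intro powr_mono2') auto
      also have "\<dots> \<le> leading z powr t"
        using P leading_le_1[OF z] t by (intro powr_mono') auto
      also have "\<dots> \<le> 2 powr B * leading z powr t"
        using mult_right_mono[of 1 "2 powr B" "leading z powr t"] B by (simp add: ge_one_powr_ge_zero)
      finally show ?thesis .
    qed
    then have 1: "norm (complex_of_real (leading z * (1 + ratio z)) powr s - complex_of_real (leading z) powr s)
        \<le> (2 powr B + 1) * leading z powr t"
      using nP norm_triangle_ineq4[of "complex_of_real (leading z * (1 + ratio z)) powr s" "complex_of_real (leading z) powr s"]
      by (simp add: algebra_simps)
    have "1 \<le> ratio z powr e" using True e by (intro ge_one_powr_ge_zero) auto
    then have "leading z powr t * 1 \<le> leading z powr t * ratio z powr e"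
      by (rule mult_left_mono) simp
    then have 2: "leading z powr t \<le> leading z powr t * ratio z powr e"
      by (simp only: mult_1_right)
    have "0 \<le> exp B * B" using B by simp
    then have 3: "2 powr B + 1 \<le> exp B * B + 2 powr B + 1" "0 \<le> exp B * B + 2 powr B + 1"
      by (auto intro: add_nonneg_nonneg)
    show ?thesis
      by (rule order_trans[OF 1 mult_mono[OF 3(1) 2 3(2)]]) simp
  next
    case False
    define L where "L = ln (1 + ratio z)"
    have L: "0 \<le> L" "L \<le> ratio z" using w by (auto simp: L_def ln_add_one_self_le_self)
    have "complex_of_real (leading z * (1 + ratio z)) powr s
        = complex_of_real (leading z) powr s * exp (s * of_real L)"
    proof -
      have ln: "ln (leading z * (1 + ratio z)) = ln (leading z) + L"
        using P w by (simp add: L_def ln_mult)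
      have "leading z * (1 + ratio z) > 0" using P w by simp
      then show ?thesis
        unfolding of_real_powr_eq_exp[OF P] of_real_powr_eq_exp[OF \<open>leading z * (1 + ratio z) > 0\<close>] ln
        by (simp add: exp_add distrib_left)
    qed
    then have "norm (complex_of_real (leading z * (1 + ratio z)) powr s - complex_of_real (leading z) powr s)
      = norm (complex_of_real (leading z) powr s) * norm (exp (s * of_real L) - 1)"
      by (simp flip: norm_mult add: algebra_simps)
    also have "\<dots> \<le> leading z powr t * (exp B * B * ratio z powr e)"
    proof (rule mult_mono[OF nP])
      have "norm (s * of_real L) \<le> B * ratio z"
        using L B by (auto simp: norm_mult intro!: mult_mono)
      moreover have "B * ratio z \<le> B" using False B by simp
      ultimately have n: "norm (s * of_real L) \<le> B * ratio z" "norm (s * of_real L) \<le> B" by auto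
      have "norm (exp (s * of_real L) - 1) \<le> exp \<bar>Re (s * of_real L)\<bar> * norm (s * of_real L)"
        using Taylor_exp[of "s * of_real L" 0] by simp
      also have "\<dots> \<le> exp B * (B * ratio z)"
        using n abs_Re_le_cmod[of "s * of_real L"] by (intro mult_mono) auto
      also have "ratio z \<le> ratio z powr e"
        using powr_mono'[of e 1 "ratio z"] w False e by simp
      finally show "norm (exp (s * of_real L) - 1) \<le> exp B * B * ratio z powr e"
        using B by (simp add: mult.assoc)
    qed auto
    also have "\<dots> \<le> (exp B * B + 2 powr B + 1) * (leading z powr t * ratio z powr e)"
      using Pt by (simp add: algebra_simps)
    finally show ?thesis .
  qed
qed

lemma integrable_usquare_powr:
  "c > -1 \<Longrightarrow> integrable lborel (\<lambda>z. indicator usquare z * fst z powr c)"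
proof -
  assume c: "c > -1"
  have "integrable lborel (\<lambda>z::real\<times>real. (indicator {0<..<1} (fst z) * fst z powr c) * indicator {0<..<1} (snd z))"
    using has_bochner_integral_product[of "\<lambda>x. indicator {0<..<1} x * x powr c" "indicator {0<..<1}"]
      has_bochner_integral_powr_unit[OF c] by (auto simp: has_bochner_integral_iff)
  then show ?thesis
    by (rule Bochner_Integration.integrable_cong[THEN iffD1, rotated -1]) (auto simp: indicator_def)
qed

text \<open>
  The exponent \<open>e\<close> is half of the room that \<open>t\<close> leaves above \<open>-1/a\<close>, measured in units of \<open>q\<close>: the
  factor \<open>x^(-q e)\<close> then lowers the exponent \<open>a t\<close> only to \<open>(a t - 1)/2 > -1\<close>, while the flat factor
  absorbs \<open>y^(b t)\<close>.
\<close>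

lemma flat_weight_bound:
  assumes t: "- 1 / real a < t" "t \<le> 0"
  defines "e \<equiv> (real a * t + 1) / (2 * real q)"
  shows "0 < e" "e \<le> 1"
    and "\<exists>K\<ge>0. \<forall>z\<in>usquare. leading z powr t * ratio z powr e \<le> K * fst z powr ((real a * t - 1) / 2)"
proof -
  have at: "0 < real a * t + 1" "real a * t + 1 \<le> 1"
    using t a2 mult_nonneg_nonpos[of "real a" t] by (auto simp: field_simps)
  then show e: "0 < e" "e \<le> 1" using q2 by (auto simp: e_def field_simps)
  obtain K where K: "K \<ge> 0" "\<And>y. y > 0 \<Longrightarrow> y powr - (- (real b * t)) * exp (- e * y powr - p) \<le> K"
    using powr_mult_flat_bounded[of p e "- (real b * t)"] p0 e t by (auto simp: mult_nonneg_nonpos)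
  show "\<exists>K\<ge>0. \<forall>z\<in>usquare. leading z powr t * ratio z powr e \<le> K * fst z powr ((real a * t - 1) / 2)"
  proof (intro exI[of _ K] conjI ballI)
    fix z assume z: "z \<in> usquare"
    then have xy: "fst z > 0" "snd z > 0" by auto
    have r: "ratio z = exp (- (snd z powr - p)) * fst z powr (- real q)"
      using xy by (simp add: ratio_def flat_exp_pos powr_minus_divide powr_realpow)
    have "ratio z powr e = exp (- e * snd z powr - p) * fst z powr (- (real q * e))"
      unfolding r powr_mult powr_powr by (simp add: powr_def)
    then have "leading z powr t * ratio z powr e
       = (fst z powr (real a * t) * fst z powr (- (real q * e))) * (snd z powr (real b * t) * exp (- e * snd z powr - p))"
      using leading_powr[OF xy] by simp
    also have "fst z powr (real a * t) * fst z powr (- (real q * e)) = fst z powr ((real a * t - 1) / 2)"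
    proof -
      have eq: "real a * t + - (real q * e) = (real a * t - 1) / 2"
        using q2 by (simp add: e_def field_simps)
      show ?thesis unfolding eq[symmetric] by (rule powr_add[symmetric])
    qed
    also have "\<dots> * (snd z powr (real b * t) * exp (- e * snd z powr - p)) \<le> fst z powr ((real a * t - 1) / 2) * K"
      using K(2)[OF xy(2)] by (intro mult_left_mono) auto
    finally show "leading z powr t * ratio z powr e \<le> K * fst z powr ((real a * t - 1) / 2)"
      by (simp add: mult.commute)
  qed (use K in auto)
qed

end

section \<open>Continuation to the half plane\<close>

text \<open>
  What is needed of the reflected test function on the quadrant. The functions \<open>c k\<close> are its Taylor
  coefficients in \<open>y\<close>; the odd ones vanish because it is even in \<open>y\<close>. One constant \<open>M\<close> bounds the
  function, its coefficients and the remainder.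
\<close>

locale flat_amplitude = flat_phase +
  fixes \<psi> :: "real \<times> real \<Rightarrow> complex" and c :: "nat \<Rightarrow> real \<Rightarrow> complex" and M :: real
  assumes amplitude_measurable [measurable]: "\<psi> \<in> borel_measurable borel"
    and amplitude_bound: "\<And>z. norm (\<psi> z) \<le> M"
    and amplitude_support: "\<And>z. fst z > 0 \<Longrightarrow> snd z > 0 \<Longrightarrow> z \<notin> usquare \<Longrightarrow> \<psi> z = 0"
    and amplitude_cont: "isCont \<psi> (0, 0)"
    and coeff_measurable [measurable]: "\<And>k. c k \<in> borel_measurable borel"
    and coeff_bound: "\<And>k x. norm (c k x) \<le> M"
    and coeff_odd: "\<And>k x. odd k \<Longrightarrow> c k x = 0"
    and taylor_remainder: "\<And>x y. (x, y) \<in> usquare \<Longrightarrow>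
          norm (\<psi> (x, y) - (\<Sum>k<b. c k x * of_real y ^ k)) \<le> M * y ^ b"
begin

definition taylor_poly :: "real \<times> real \<Rightarrow> complex" where
  "taylor_poly z = (\<Sum>k<b. c k (fst z) * of_real (snd z) ^ k)"

definition quadrant_zeta :: "complex \<Rightarrow> complex" where
  "quadrant_zeta s = (LINT z|lborel. indicator usquare z *\<^sub>R
     (complex_of_real (leading z * (1 + ratio z)) powr s * \<psi> z))"

definition flat_part :: "complex \<Rightarrow> complex" where
  "flat_part s = (LINT z|lborel. indicator usquare z *\<^sub>R
     ((complex_of_real (leading z * (1 + ratio z)) powr s - complex_of_real (leading z) powr s) * \<psi> z))"

definition remainder_part :: "complex \<Rightarrow> complex" where
  "remainder_part s = (LINT z|lborel. indicator usquare z *\<^sub>R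
     (complex_of_real (leading z) powr s * (\<psi> z - taylor_poly z)))"

definition coeff_mellin :: "nat \<Rightarrow> complex \<Rightarrow> complex" where
  "coeff_mellin k s = (LINT x|lborel. indicator {0<..<1} x *\<^sub>R
     (complex_of_real x powr (of_nat a * s) * c k x))"

text \<open>
  On \<open>Re s > 0\<close> this is \<open>quadrant_zeta\<close>: the integral of \<open>y^(b s + k)\<close> over the unit interval is
  \<open>1 / (b s + k + 1)\<close>, and each summand below is meromorphic on the whole half plane.
\<close>

definition continued_zeta :: "complex \<Rightarrow> complex" where
  "continued_zeta s = (\<Sum>k<b. coeff_mellin k s / (of_nat b * s + of_nat k + 1))
     + remainder_part s + flat_part s"

lemma M_nonneg: "M \<ge> 0"
  using amplitude_bound[of 0] norm_ge_zero order_trans by blast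

lemma taylor_poly_measurable [measurable]: "taylor_poly \<in> borel_measurable borel"
  unfolding taylor_poly_def by measurable

lemma half_plane_open: "open half_plane"
  by (rule open_halfspace_Re_gt)

lemma Re_pos_imp_half_plane: "Re s > 0 \<Longrightarrow> s \<in> half_plane"
proof -
  assume "Re s > 0"
  moreover have "- 1 / real a < 0" using a2 by simp
  ultimately have "- 1 / real a < Re s" by (rule less_trans[rotated])
  then show ?thesis by simp
qed

lemma flat_part_measurable [measurable]:
  "(\<lambda>z. indicator usquare z *\<^sub>R
     ((complex_of_real (leading z * (1 + ratio z)) powr s - complex_of_real (leading z) powr s) * \<psi> z))
   \<in> borel_measurable borel"
  by measurable

lemma remainder_part_measurable [measurable]:
  "(\<lambda>z. indicator usquare z *\<^sub>R
     (complex_of_real (leading z) powr s * (\<psi> z - taylor_poly z))) \<in> borel_measurable borel"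
  by measurable

lemma coeff_mellin_measurable [measurable]:
  "(\<lambda>x. indicator {0<..<1} x *\<^sub>R (complex_of_real x powr (of_nat a * s) * c k x)) \<in> borel_measurable borel"
  by measurable

text \<open>
  This is where the flatness of the exponential enters: the majorant is integrable although
  \<open>b Re s\<close> may be far below \<open>-1\<close>.
\<close>

lemma flat_part_dominated:
  assumes "s0 \<in> half_plane"
  shows "\<exists>r>0. \<exists>g. integrable lborel g \<and> (\<forall>s\<in>ball s0 r. \<forall>z.
     norm (indicator usquare z *\<^sub>R
       ((complex_of_real (leading z * (1 + ratio z)) powr s - complex_of_real (leading z) powr s) * \<psi> z)) \<le> g z)"
proof -
  obtain r t B where r: "r > 0" and t: "- 1 / real a < t" "t \<le> 0" and B: "1 \<le> B"
    and nb: "\<And>s. s \<in> ball s0 r \<Longrightarrow> t \<le> Re s \<and> norm s \<le> B"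
    using half_plane_nbhd[OF assms] by blast
  define e where "e = (real a * t + 1) / (2 * real q)"
  define d where "d = (real a * t - 1) / 2"
  note e = flat_weight_bound[OF t, folded e_def]
  obtain K where K: "K \<ge> 0" "\<And>z. z \<in> usquare \<Longrightarrow> leading z powr t * ratio z powr e \<le> K * fst z powr d"
    using e(3) unfolding d_def by blast
  define E where "E = exp B * B + 2 powr B + 1"
  have E: "E \<ge> 0" using B by (simp add: E_def)
  have d: "d > -1" using t a2 by (simp add: d_def field_simps)
  show ?thesis
  proof (rule exI[of _ r], intro conjI r, rule exI[of _ "\<lambda>z. E * K * M * (indicator usquare z * fst z powr d)"],
      intro conjI ballI allI)
    show "integrable lborel (\<lambda>z. E * K * M * (indicator usquare z * fst z powr d))"
      using integrable_usquare_powr[OF d] by (rule integrable_mult_right)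
    fix s z assume s: "s \<in> ball s0 r"
    show "norm (indicator usquare z *\<^sub>R
       ((complex_of_real (leading z * (1 + ratio z)) powr s - complex_of_real (leading z) powr s) * \<psi> z))
       \<le> E * K * M * (indicator usquare z * fst z powr d)"
    proof (cases "z \<in> usquare")
      case True
      have "norm (complex_of_real (leading z * (1 + ratio z)) powr s - complex_of_real (leading z) powr s)
          \<le> E * (leading z powr t * ratio z powr e)"
        unfolding E_def by (rule flat_difference_bound) (use True t B e nb[OF s] in auto)
      also have "\<dots> \<le> E * (K * fst z powr d)"
        by (intro mult_left_mono K True E)
      finally have "norm (complex_of_real (leading z * (1 + ratio z)) powr s - complex_of_real (leading z) powr s)
          * norm (\<psi> z) \<le> E * (K * fst z powr d) * M"
        using amplitude_bound[of z] E K(1) M_nonneg by (intro mult_mono) auto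
      then show ?thesis using True by (simp add: norm_mult mult_ac del: of_real_mult of_real_add)
    qed auto
  qed
qed

text \<open>
  The factor \<open>y^b\<close> from Taylor's theorem offsets \<open>y^(b t)\<close> because \<open>t > -1/a \<ge> -1\<close>.
\<close>

lemma remainder_part_bound:
  assumes t: "- 1 / real a < t" "t \<le> 0" "t \<le> Re s"
  shows "norm (indicator usquare z *\<^sub>R
       (complex_of_real (leading z) powr s * (\<psi> z - taylor_poly z)))
     \<le> M * (indicator usquare z * fst z powr (real a * t))"
proof (cases "z \<in> usquare")
  case True
  then have xy: "0 < fst z" "0 < snd z" "snd z < 1" by auto
  have "norm (complex_of_real (leading z) powr s) * norm (\<psi> z - taylor_poly z)
      \<le> (fst z powr (real a * t) * snd z powr (real b * t)) * (M * snd z ^ b)"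
    using leading_powr_bound[OF True t(3)] taylor_remainder[of "fst z" "snd z"] True
    by (intro mult_mono) (auto simp: leading_powr taylor_poly_def)
  also have "\<dots> = M * fst z powr (real a * t) * snd z powr (real b * t + real b)"
    using xy by (simp add: powr_add powr_realpow)
  also have "\<dots> \<le> M * fst z powr (real a * t) * 1"
  proof (intro mult_left_mono)
    have "- 1 \<le> - 1 / real a" using a2 by simp
    then have "- 1 \<le> t" using t by linarith
    then have "real b * t + real b \<ge> 0"
      using mult_left_mono[of "-1" t "real b"] by simp
    then show "snd z powr (real b * t + real b) \<le> 1"
      using xy by (intro powr_le1) auto
  qed (use M_nonneg in auto)
  finally show ?thesis using True by (simp add: norm_mult)
qed auto

lemma coeff_mellin_bound:
  assumes t: "t \<le> Re s"
  shows "norm (indicator {0<..<1} x *\<^sub>R (complex_of_real x powr (of_nat a * s) * c k x))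
     \<le> M * (indicator {0<..<1} x * x powr (real a * t))"
proof (cases "x \<in> {0<..<1}")
  case True
  have "norm (complex_of_real x powr (of_nat a * s)) \<le> x powr (real a * t)"
    using True t a2 by (auto simp: norm_of_real_powr intro!: powr_mono' mult_left_mono)
  then have "norm (complex_of_real x powr (of_nat a * s)) * norm (c k x) \<le> x powr (real a * t) * M"
    using coeff_bound[of k x] by (intro mult_mono) auto
  then show ?thesis using True by (simp add: norm_mult mult.commute)
qed auto

lemma a_mult_gt: "- 1 / real a < t \<Longrightarrow> real a * t > -1"
  using a2 by (simp add: field_simps)

lemma flat_part_integrable:
  "s \<in> half_plane \<Longrightarrow> integrable lborel (\<lambda>z. indicator usquare z *\<^sub>R
     ((complex_of_real (leading z * (1 + ratio z)) powr s - complex_of_real (leading z) powr s) * \<psi> z))"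
proof -
  assume "s \<in> half_plane"
  from flat_part_dominated[OF this] obtain r g where r: "r > 0" and g: "integrable lborel g" and
    bd: "\<And>s' z. s' \<in> ball s r \<Longrightarrow> norm (indicator usquare z *\<^sub>R
       ((complex_of_real (leading z * (1 + ratio z)) powr s' - complex_of_real (leading z) powr s') * \<psi> z)) \<le> g z"
    by blast
  have "norm (indicator usquare z *\<^sub>R
       ((complex_of_real (leading z * (1 + ratio z)) powr s - complex_of_real (leading z) powr s) * \<psi> z)) \<le> norm (g z)" for z
    using order_trans[OF bd abs_ge_self] r by simp
  then show ?thesis
    by (intro Bochner_Integration.integrable_bound[OF g] AE_I2) simp_all
qed

lemma remainder_part_integrable:
  assumes "s \<in> half_plane"
  shows "integrable lborel (\<lambda>z. indicator usquare z *\<^sub>R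
     (complex_of_real (leading z) powr s * (\<psi> z - taylor_poly z)))"
proof (rule Bochner_Integration.integrable_bound)
  show "integrable lborel (\<lambda>z. M * (indicator usquare z * fst z powr (real a * min 0 (Re s))))"
    using assms a2 by (intro integrable_mult_right integrable_usquare_powr a_mult_gt) auto
  show "AE z in lborel. norm (indicator usquare z *\<^sub>R
     (complex_of_real (leading z) powr s * (\<psi> z - taylor_poly z)))
       \<le> norm (M * (indicator usquare z * fst z powr (real a * min 0 (Re s))))"
    using assms a2 M_nonneg by (intro AE_I2 order_trans[OF remainder_part_bound[of "min 0 (Re s)"]]) auto
qed auto

lemma coeff_mellin_integrable:
  assumes "s \<in> half_plane"
  shows "integrable lborel (\<lambda>x. indicator {0<..<1} x *\<^sub>R (complex_of_real x powr (of_nat a * s) * c k x))"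
proof (rule Bochner_Integration.integrable_bound)
  show "integrable lborel (\<lambda>x. M * (indicator {0<..<1} x * x powr (real a * Re s)))"
    using has_bochner_integral_powr_unit[OF a_mult_gt[of "Re s"]] assms
    by (intro integrable_mult_right) (auto simp: has_bochner_integral_iff)
  show "AE x in lborel. norm (indicator {0<..<1} x *\<^sub>R (complex_of_real x powr (of_nat a * s) * c k x))
       \<le> norm (M * (indicator {0<..<1} x * x powr (real a * Re s)))"
    using M_nonneg by (intro AE_I2 order_trans[OF coeff_mellin_bound[of "Re s"]]) auto
qed auto

lemma flat_part_holomorphic: "flat_part holomorphic_on half_plane"
  unfolding flat_part_def
proof (rule holomorphic_on_lebesgue_integral[OF half_plane_open])
  fix s0 assume "s0 \<in> half_plane"
  from flat_part_dominated[OF this]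
  show "\<exists>r>0. \<exists>g. integrable lborel g \<and> (\<forall>s\<in>ball s0 r \<inter> half_plane. \<forall>z\<in>space lborel.
     norm (indicator usquare z *\<^sub>R
       ((complex_of_real (leading z * (1 + ratio z)) powr s - complex_of_real (leading z) powr s) * \<psi> z)) \<le> g z)"
    by blast
qed (auto intro!: holomorphic_intros)

lemma remainder_part_holomorphic: "remainder_part holomorphic_on half_plane"
  unfolding remainder_part_def
proof (rule holomorphic_on_lebesgue_integral[OF half_plane_open])
  fix s0 assume "s0 \<in> half_plane"
  then obtain r t B where r: "r > 0" and t: "- 1 / real a < t" "t \<le> 0"
    and nb: "\<And>s. s \<in> ball s0 r \<Longrightarrow> t \<le> Re s \<and> norm s \<le> (B::real)"
    using half_plane_nbhd by blast
  have "integrable lborel (\<lambda>z. M * (indicator usquare z * fst z powr (real a * t)))"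
    using t by (intro integrable_mult_right integrable_usquare_powr a_mult_gt)
  then show "\<exists>r>0. \<exists>g. integrable lborel g \<and> (\<forall>s\<in>ball s0 r \<inter> half_plane. \<forall>z\<in>space lborel.
     norm (indicator usquare z *\<^sub>R (complex_of_real (leading z) powr s * (\<psi> z - taylor_poly z))) \<le> g z)"
    using r nb t remainder_part_bound by (intro exI[of _ r] conjI r) blast
qed (auto intro!: holomorphic_intros)

lemma coeff_mellin_holomorphic: "coeff_mellin k holomorphic_on half_plane"
  unfolding coeff_mellin_def
proof (rule holomorphic_on_lebesgue_integral[OF half_plane_open])
  fix s0 assume "s0 \<in> half_plane"
  then obtain r t B where r: "r > 0" and t: "- 1 / real a < t" "t \<le> 0"
    and nb: "\<And>s. s \<in> ball s0 r \<Longrightarrow> t \<le> Re s \<and> norm s \<le> (B::real)"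
    using half_plane_nbhd by blast
  have "integrable lborel (\<lambda>x. M * (indicator {0<..<1} x * x powr (real a * t)))"
    using has_bochner_integral_powr_unit[OF a_mult_gt[OF t(1)]]
    by (intro integrable_mult_right) (auto simp: has_bochner_integral_iff)
  then show "\<exists>r>0. \<exists>g. integrable lborel g \<and> (\<forall>s\<in>ball s0 r \<inter> half_plane. \<forall>x\<in>space lborel.
     norm (indicator {0<..<1} x *\<^sub>R (complex_of_real x powr (of_nat a * s) * c k x)) \<le> g x)"
    using r nb t coeff_mellin_bound by (intro exI[of _ r] conjI r) blast
qed (auto intro!: holomorphic_intros)

lemma continued_zeta_meromorphic: "continued_zeta meromorphic_on half_plane"
proof -
  have "g meromorphic_on half_plane" if "g holomorphic_on half_plane" for g
    using that half_plane_open analytic_on_open analytic_on_imp_meromorphic_on by blast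
  note mero = this[OF flat_part_holomorphic] this[OF remainder_part_holomorphic]
    this[OF coeff_mellin_holomorphic]
  show ?thesis
    unfolding continued_zeta_def
    by (intro meromorphic_on_add meromorphic_on_sum meromorphic_on_divide meromorphic_on_mult
        meromorphic_on_const meromorphic_on_id mero)
qed

lemma taylor_term_integral:
  assumes "Re s > 0"
  shows "has_bochner_integral lborel (\<lambda>z. indicator usquare z *\<^sub>R
     (complex_of_real (leading z) powr s * (c k (fst z) * of_real (snd z) ^ k)))
     (coeff_mellin k s / (of_nat b * s + of_nat k + 1))"
proof -
  let ?f = "\<lambda>x. indicator {0<..<1} x *\<^sub>R (complex_of_real x powr (of_nat a * s) * c k x)"
  let ?g = "\<lambda>y. indicator {0<..<1} y *\<^sub>R complex_of_real y powr (of_nat b * s + of_nat k)"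
  have "0 < real b * Re s" using assms ab by auto
  then have w: "Re (of_nat b * s + of_nat k) > 0" by simp
  have f: "integrable lborel ?f"
    using assms by (intro coeff_mellin_integrable Re_pos_imp_half_plane)
  note g = has_bochner_integral_complex_powr_unit[OF w]
  have "has_bochner_integral lborel (\<lambda>z. ?f (fst z) * ?g (snd z))
    (coeff_mellin k s * (1 / (of_nat b * s + of_nat k + 1)))"
    using has_bochner_integral_product[OF f, of ?g] g
    by (simp add: coeff_mellin_def has_bochner_integral_iff)
  moreover have "?f (fst z) * ?g (snd z) = indicator usquare z *\<^sub>R
     (complex_of_real (leading z) powr s * (c k (fst z) * of_real (snd z) ^ k))" for z
    using leading_powr_complex[of "fst z" "snd z" s]
    by (cases z) (auto simp: indicator_def powr_add powr_nat' mult_ac)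
  ultimately show ?thesis by simp
qed

text \<open>
  All three pieces are integrable for \<open>Re s > 0\<close>, and their integrands add up.
\<close>

lemma continued_zeta_eq:
  assumes "Re s > 0"
  shows "continued_zeta s = quadrant_zeta s"
proof -
  have s: "s \<in> half_plane" using assms by (rule Re_pos_imp_half_plane)
  have T: "has_bochner_integral lborel (\<lambda>z. indicator usquare z *\<^sub>R
     (complex_of_real (leading z) powr s * taylor_poly z))
     (\<Sum>k<b. coeff_mellin k s / (of_nat b * s + of_nat k + 1))"
    unfolding taylor_poly_def sum_distrib_left scaleR_sum_right
    by (intro has_bochner_integral_sum taylor_term_integral assms)
  have R: "has_bochner_integral lborel (\<lambda>z. indicator usquare z *\<^sub>R
     (complex_of_real (leading z) powr s * (\<psi> z - taylor_poly z))) (remainder_part s)"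
    using remainder_part_integrable[OF s] by (simp add: has_bochner_integral_iff remainder_part_def)
  have W: "has_bochner_integral lborel (\<lambda>z. indicator usquare z *\<^sub>R
     ((complex_of_real (leading z * (1 + ratio z)) powr s - complex_of_real (leading z) powr s) * \<psi> z)) (flat_part s)"
    using flat_part_integrable[OF s] unfolding has_bochner_integral_iff flat_part_def by simp
  have "has_bochner_integral lborel (\<lambda>z. indicator usquare z *\<^sub>R
     (complex_of_real (leading z * (1 + ratio z)) powr s * \<psi> z)) (continued_zeta s)"
    using has_bochner_integral_add[OF has_bochner_integral_add[OF T R] W]
    by (simp add: continued_zeta_def algebra_simps)
  then show ?thesis
    by (simp add: quadrant_zeta_def has_bochner_integral_iff)
qed

end

section \<open>Majorant and limit of the rescaled integrand\<close>

context flat_phase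
begin

text \<open>
  After \<open>x = u^(1/\<tau>)\<close>, \<open>y = \<tau>^(1/p) v\<close> the quantity \<open>ratio\<close> is the power \<open>1/\<tau>\<close> of this function, which
  no longer depends on \<open>\<tau>\<close>.
\<close>

definition blowup_ratio :: "real \<times> real \<Rightarrow> real" where
  "blowup_ratio w = exp (- (snd w powr (-p))) * fst w powr (- real q)"

text \<open>
  Minus the pointwise limit of the rescaled integrand (for amplitude \<open>1\<close>). The null set
  \<open>blowup_ratio w = 1\<close> is given its true limit value, so that convergence holds everywhere.
\<close>

definition blowup_limit :: "real \<times> real \<Rightarrow> real" where
  "blowup_limit w = indicator quadrant w * (snd w powr (- real b / real a) *
     (if blowup_ratio w > 1 then 1 else if blowup_ratio w = 1 then 1 - 2 powr (- 1 / real a) else 0))"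

text \<open>
  A product of functions of \<open>u\<close> and \<open>v\<close>. The exponents \<open>-b/a\<close> and \<open>-(1 + b/a)/2\<close> of \<open>v\<close> enclose the
  exponent \<open>b s\<close> for all small \<open>\<tau>\<close>; both are below \<open>-1\<close> since \<open>a < b\<close>, which gives integrability at
  infinity, while the exponential takes care of \<open>v\<close> near \<open>0\<close>.
\<close>

definition blowup_majorant :: "real \<times> real \<Rightarrow> real" where
  "blowup_majorant w = (indicator {0<..<1} (fst w) * fst w powr (- 1 / 2) + indicator {1..} (fst w) * fst w powr (-2))
     * (indicator {0<..} (snd w) * (snd w powr (- (real b / real a)) * exp (- (1 / (2 * real q)) * snd w powr (-p)))
      + indicator {0<..} (snd w) * (snd w powr (- ((1 + real b / real a) / 2)) * exp (- (1 / (2 * real q)) * snd w powr (-p))))"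

lemma ratio_ba: "real b / real a > 1"
  using ab a2 by simp

lemma blowup_majorant_integrable: "integrable lborel blowup_majorant"
proof -
  have 1: "integrable lborel (\<lambda>u::real. indicator {0<..<1} u * u powr (- 1 / 2) + indicator {1..} u * u powr (-2))"
    using has_bochner_integral_powr_unit[of "- 1 / 2"] integrable_powr_at_infinity[of 2]
    by (auto simp: has_bochner_integral_iff)
  have 2: "integrable lborel (\<lambda>v::real. indicator {0<..} v * (v powr (- (real b / real a)) * exp (- (1 / (2 * real q)) * v powr (-p)))
      + indicator {0<..} v * (v powr (- ((1 + real b / real a) / 2)) * exp (- (1 / (2 * real q)) * v powr (-p))))"
    using ratio_ba q2 p0 by (intro Bochner_Integration.integrable_add integrable_flat_powr) auto
  show ?thesis
    using has_bochner_integral_product[OF 1 2] unfolding blowup_majorant_def[abs_def]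
    by (simp add: has_bochner_integral_iff)
qed

lemma blowup_majorant_nonneg: "0 \<le> blowup_majorant w"
  by (auto simp: blowup_majorant_def intro!: mult_nonneg_nonneg add_nonneg_nonneg)

lemma blowup_ratio_measurable [measurable]: "blowup_ratio \<in> borel_measurable borel"
  unfolding blowup_ratio_def by measurable

lemma quadrant_measurable [measurable]: "quadrant \<in> sets borel"
  by (intro borel_open open_Times) auto

lemma blowup_limit_measurable [measurable]: "blowup_limit \<in> borel_measurable borel"
  unfolding blowup_limit_def by measurable

lemma blowup_ratio_pos: "w \<in> quadrant \<Longrightarrow> blowup_ratio w > 0"
  by (auto simp: blowup_ratio_def)

text \<open>
  Write \<open>R\<close> for the ratio and use \<open>min 1 R \<le> R^\<theta>\<close> for \<open>0 \<le> \<theta> \<le> 1\<close>. The choice \<open>\<theta> = 1/(2 q)\<close> is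
  integrable in \<open>u\<close> near \<open>0\<close>, the choice \<open>\<theta> = 1\<close> is integrable near infinity.
\<close>

lemma min_blowup_ratio_le:
  assumes "w \<in> quadrant"
  shows "min 1 (blowup_ratio w)
    \<le> (indicator {0<..<1} (fst w) * fst w powr (- 1 / 2) + indicator {1..} (fst w) * fst w powr (-2))
        * exp (- (1 / (2 * real q)) * snd w powr (-p))"
proof -
  obtain u v where w: "w = (u, v)" "u > 0" "v > 0" using assms by auto
  have R: "blowup_ratio w > 0" using blowup_ratio_pos[OF assms] .
  define \<theta> where "\<theta> = 1 / (2 * real q)"
  have \<theta>: "0 < \<theta>" "\<theta> \<le> 1" using q2 by (auto simp: \<theta>_def field_simps)
  show ?thesis
  proof (cases "u < 1")
    case True
    have "min 1 (blowup_ratio w) \<le> blowup_ratio w powr \<theta>"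
    proof (cases "blowup_ratio w \<ge> 1")
      case True
      then show ?thesis using \<theta> by (simp add: ge_one_powr_ge_zero)
    next
      case False
      then show ?thesis using powr_mono'[of \<theta> 1 "blowup_ratio w"] R \<theta> by simp
    qed
    also have "\<dots> = u powr (- 1 / 2) * exp (- \<theta> * v powr (-p))"
    proof -
      have eq: "- real q * \<theta> = - 1 / 2" using q2 by (simp add: \<theta>_def)
      have "blowup_ratio w powr \<theta> = exp (- (v powr (-p))) powr \<theta> * u powr (- real q * \<theta>)"
        using w by (simp add: blowup_ratio_def powr_mult powr_powr)
      then show ?thesis unfolding eq by (simp add: exp_powr_real mult.commute)
    qed
    finally show ?thesis using True w by (simp add: \<theta>_def)
  next
    case False
    have "blowup_ratio w = exp (- (v powr (-p))) * u powr (- real q)" by (simp add: blowup_ratio_def w)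
    also have "\<dots> \<le> exp (- \<theta> * v powr (-p)) * u powr (-2)"
    proof (rule mult_mono)
      show "exp (- (v powr (-p))) \<le> exp (- \<theta> * v powr (-p))"
        using \<theta> mult_right_mono[of \<theta> 1 "v powr (-p)"] by simp
      show "u powr (- real q) \<le> u powr (-2)" using False q2 by (intro powr_mono) auto
    qed auto
    finally show ?thesis using False w by (simp add: \<theta>_def mult.commute)
  qed
qed

lemma powr_between:
  fixes v x y z :: real
  assumes "v > 0" "x \<le> y" "y \<le> z"
  shows "v powr y \<le> v powr x + v powr z"
proof (cases "v \<le> 1")
  case True
  then have "v powr y \<le> v powr x" using assms by (intro powr_mono') auto
  then show ?thesis by (simp add: add_increasing2)
next
  case False
  then have "v powr y \<le> v powr z" using assms by (intro powr_mono) auto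
  then show ?thesis by (simp add: add_increasing)
qed

text \<open>
  For \<open>-1 \<le> \<sigma> \<le> 0\<close> one has \<open>0 \<le> 1 - (1+X)^\<sigma> \<le> min 1 X\<close>, and \<open>min 1 (R^(1/\<tau>)) \<le> min 1 R\<close> as \<open>\<tau> < 1\<close>.
  The upper bound on \<open>\<tau>\<close> is the one that keeps \<open>b \<sigma>\<close> below \<open>-(1 + b/a)/2\<close>.
\<close>

lemma blowup_integrand_bound:
  assumes w: "w \<in> quadrant" and \<tau>: "0 < \<tau>" "\<tau> < (1 - real a / real b) / 2"
  defines "\<sigma> \<equiv> (\<tau> - 1) / real a"
  shows "snd w powr (real b * \<sigma>) * \<bar>(1 + blowup_ratio w powr (1 / \<tau>)) powr \<sigma> - 1\<bar> \<le> blowup_majorant w"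
proof -
  obtain u v where uv: "w = (u, v)" "u > 0" "v > 0" using w by auto
  define R where "R = blowup_ratio w"
  have R: "R > 0" using blowup_ratio_pos[OF w] by (simp add: R_def)
  have abr: "0 < real a / real b" "real a / real b < 1" using ab a2 by auto
  then have "(1 - real a / real b) / 2 < 1" by simp
  then have \<tau>1: "\<tau> < 1" by (rule less_trans[OF \<tau>(2)])
  have \<sigma>: "-1 \<le> \<sigma>" "\<sigma> \<le> 0" using \<tau> \<tau>1 a2 by (auto simp: \<sigma>_def field_simps)
  define X where "X = R powr (1 / \<tau>)"
  have X: "X > 0" using R by (simp add: X_def)
  have le1: "(1 + X) powr \<sigma> \<le> 1" using powr_mono[of \<sigma> 0 "1 + X"] X \<sigma> by simp
  have "(1 + X) powr (-1) \<le> (1 + X) powr \<sigma>" using X \<sigma> by (intro powr_mono) auto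
  moreover have "(1 + X) powr (-1) = 1 - X / (1 + X)" using X by (simp add: powr_minus field_simps)
  moreover have "X / (1 + X) \<le> X / 1" using X by (intro divide_left_mono) auto
  ultimately have "1 - (1 + X) powr \<sigma> \<le> X" by simp
  moreover have "1 - (1 + X) powr \<sigma> \<le> 1" by simp
  moreover have "min 1 X \<le> min 1 R"
  proof (cases "R \<le> 1")
    case True
    then have "X \<le> R powr 1" unfolding X_def using R \<tau> \<tau>1 by (intro powr_mono') auto
    then show ?thesis using R by simp
  qed auto
  ultimately have 1: "\<bar>(1 + X) powr \<sigma> - 1\<bar> \<le> min 1 R" using le1 by linarith
  have "real b * \<sigma> = - (real b / real a) * (1 - \<tau>)" using a2 by (simp add: \<sigma>_def field_simps)
  moreover have "real b / real a * (1 - \<tau>) \<le> real b / real a"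
    using \<tau> a2 mult_left_mono[of "1 - \<tau>" 1 "real b / real a"] by simp
  moreover have "(1 + real b / real a) / 2 \<le> real b / real a * (1 - \<tau>)"
  proof -
    have "real b / real a * \<tau> \<le> real b / real a * ((1 - real a / real b) / 2)"
      using \<tau> by (intro mult_left_mono) auto
    also have "\<dots> = (real b / real a - 1) / 2" using a2 ab by (simp add: field_simps)
    finally have le: "real b / real a * \<tau> \<le> (real b / real a - 1) / 2" .
    have "(1 + x) / 2 \<le> x * (1 - t)" if "x * t \<le> (x - 1) / 2" for x t :: real
      using that by (simp add: field_simps)
    then show ?thesis using le .
  qed
  ultimately have 2: "v powr (real b * \<sigma>) \<le> v powr (- (real b / real a)) + v powr (- ((1 + real b / real a) / 2))"
    using uv by (intro powr_between) auto
  have "snd w powr (real b * \<sigma>) * \<bar>(1 + X) powr \<sigma> - 1\<bar>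
     \<le> (v powr (- (real b / real a)) + v powr (- ((1 + real b / real a) / 2))) * min 1 R"
    using 1 2 uv by (intro mult_mono) auto
  also have "\<dots> \<le> (v powr (- (real b / real a)) + v powr (- ((1 + real b / real a) / 2))) *
      ((indicator {0<..<1} u * u powr (- 1 / 2) + indicator {1..} u * u powr (-2))
        * exp (- (1 / (2 * real q)) * v powr (-p)))"
    using min_blowup_ratio_le[OF w] unfolding R_def uv fst_conv snd_conv by (intro mult_left_mono) auto
  also have "\<dots> = blowup_majorant w"
    using uv by (simp add: blowup_majorant_def algebra_simps)
  finally show ?thesis by (simp add: X_def R_def)
qed

text \<open>
  Positivity is read off on the box \<open>u < exp (-1)\<close>, \<open>1 < v < 2\<close>, where \<open>blowup_ratio > 1\<close>.
\<close>

lemma blowup_limit_integral_pos: "integrable lborel blowup_limit" "(LINT w|lborel. blowup_limit w) > 0"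
proof -
  have two: "0 < 1 - 2 powr (- 1 / real a)" "1 - 2 powr (- 1 / real a) \<le> 1"
    using a2 powr_less_mono[of "- 1 / real a" 0 2] by auto
  have nonneg: "blowup_limit w \<ge> 0" for w
    using two by (auto simp: blowup_limit_def)
  have le: "blowup_limit w \<le> blowup_majorant w" for w
  proof (cases "w \<in> quadrant")
    case True
    obtain u v where uv: "w = (u, v)" "u > 0" "v > 0" using True by auto
    have "blowup_limit w \<le> v powr (- (real b / real a)) * min 1 (blowup_ratio w)"
      using two uv blowup_ratio_pos[OF True] by (auto simp: blowup_limit_def)
    also have "\<dots> \<le> v powr (- (real b / real a)) * ((indicator {0<..<1} u * u powr (- 1 / 2) + indicator {1..} u * u powr (-2))
        * exp (- (1 / (2 * real q)) * v powr (-p)))"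
      using min_blowup_ratio_le[OF True] unfolding uv fst_conv snd_conv by (intro mult_left_mono) auto
    also have "\<dots> \<le> blowup_majorant w"
      using uv by (simp add: blowup_majorant_def algebra_simps)
    finally show ?thesis .
  next
    case False
    then show ?thesis by (simp add: blowup_limit_def blowup_majorant_def)
  qed
  show int: "integrable lborel blowup_limit"
    by (rule Bochner_Integration.integrable_bound[OF blowup_majorant_integrable])
       (use nonneg le in \<open>auto intro!: AE_I2 intro: order_trans[OF le abs_ge_self]\<close>)
  have prod: "has_bochner_integral lborel (\<lambda>w :: real \<times> real. (2 powr (- real b / real a) * indicator {0<..<exp (-1)} (fst w)) * indicator {1<..<2} (snd w))
     (2 powr (- real b / real a) * exp (-1))"
    using has_bochner_integral_product[of "\<lambda>u::real. 2 powr (- real b / real a) * indicator {0<..<exp (-1)} u" "\<lambda>v::real. indicator {1<..<2} v"]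
    by simp
  have "0 < 2 powr (- real b / real a) * exp (-1 :: real)" by simp
  also have "\<dots> = integral\<^sup>L lborel (\<lambda>w :: real \<times> real. (2 powr (- real b / real a) * indicator {0<..<exp (-1)} (fst w)) * indicator {1<..<2} (snd w))"
    using prod by (simp add: has_bochner_integral_iff)
  also have "\<dots> \<le> (LINT w|lborel. blowup_limit w)"
  proof (rule integral_mono)
    show "integrable lborel (\<lambda>w :: real \<times> real. (2 powr (- real b / real a) * indicator {0<..<exp (-1)} (fst w)) * indicator {1<..<2} (snd w))"
      using prod by (simp add: has_bochner_integral_iff)
    fix w :: "real \<times> real"
    show "(2 powr (- real b / real a) * indicator {0<..<exp (-1)} (fst w)) * indicator {1<..<2} (snd w) \<le> blowup_limit w"
    proof (cases "fst w \<in> {0<..<exp (-1)} \<and> snd w \<in> {1<..<2}")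
      case True
      then have u: "0 < fst w" "fst w < exp (-1)" and v: "1 < snd w" "snd w < 2" by auto
      have "snd w powr (-p) \<le> 1" using v p0 powr_mono[of "-p" 0 "snd w"] by simp
      then have 1: "exp (-1) \<le> exp (- (snd w powr (-p)))" by simp
      have "exp (1 :: real) \<le> exp (-1) powr (- real q)"
        using q2 by (simp add: exp_powr_real)
      also have "\<dots> < fst w powr (- real q)"
        using u q2 by (intro powr_less_mono2_neg) auto
      finally have "exp (-1) * exp 1 < exp (- (snd w powr (-p))) * fst w powr (- real q)"
        using 1 by (intro mult_le_less_imp_less) auto
      then have "blowup_ratio w > 1" by (simp add: blowup_ratio_def exp_minus)
      moreover have "2 powr (- real b / real a) \<le> snd w powr (- real b / real a)"
        using v by (intro powr_mono2') auto
      ultimately show ?thesis using True by (cases w) (auto simp: blowup_limit_def)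
    next
      case False
      then show ?thesis using nonneg[of w] by (auto simp: indicator_def)
    qed
  qed (rule int)
  finally show "(LINT w|lborel. blowup_limit w) > 0" .
qed

end

section \<open>Asymptotics of the flat part\<close>

context flat_amplitude
begin

text \<open>
  The integrand of the flat part in the coordinates \<open>u, v\<close>, stripped of all explicit powers of \<open>\<tau>\<close>.
  The Jacobian \<open>u^(1/\<tau> - 1) / \<tau>\<close> cancels \<open>x^(\<tau> - 1)\<close> up to the factor \<open>1/\<tau>\<close>.
\<close>

definition rescaled_integrand :: "real \<Rightarrow> real \<times> real \<Rightarrow> complex" where
  "rescaled_integrand \<tau> w = complex_of_real (indicator quadrant w *
      (snd w powr (real b * ((\<tau> - 1) / real a)) * ((1 + blowup_ratio w powr (1 / \<tau>)) powr ((\<tau> - 1) / real a) - 1)))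
     * \<psi> (fst w powr (1 / \<tau>), \<tau> powr (1 / p) * snd w)"

lemma pair_powr_measurable [measurable]:
  "(\<lambda>w :: real \<times> real. (fst w powr d, k * snd w)) \<in> borel \<rightarrow>\<^sub>M borel"
proof -
  have "(\<lambda>w :: real \<times> real. (fst w powr d, k * snd w)) \<in> borel \<rightarrow>\<^sub>M borel \<Otimes>\<^sub>M borel"
    by measurable
  then show ?thesis by (simp add: borel_prod)
qed

lemma rescaled_integrand_measurable [measurable]: "rescaled_integrand \<tau> \<in> borel_measurable borel"
  unfolding rescaled_integrand_def by measurable

text \<open>
  Bookkeeping of the powers of \<open>\<tau>\<close>: the Jacobian gives \<open>\<tau>^(1/p - 1)\<close> and \<open>y^(b s)\<close> gives
  \<open>\<tau>^(b s/p)\<close>; the total exponent is \<open>-1 - \<kappa> + \<tau> b/(a p)\<close>.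
\<close>

lemma flat_part_rescaled:
  assumes \<tau>: "0 < \<tau>" "\<tau> < 1"
  shows "complex_of_real (\<tau> powr (1 + (real b / real a - 1) / p)) * flat_part (complex_of_real ((\<tau> - 1) / real a))
     = complex_of_real (\<tau> powr (\<tau> * (real b / (real a * p)))) * (LINT w|lborel. rescaled_integrand \<tau> w)"
proof -
  define \<sigma> where "\<sigma> = (\<tau> - 1) / real a"
  define d where "d = 1 / \<tau>"
  define l where "l = \<tau> powr (1 / p)"
  have d: "d > 0" and l: "l > 0" using \<tau> by (auto simp: d_def l_def)
  define h where "h z = (complex_of_real (leading z * (1 + ratio z)) powr of_real \<sigma> - complex_of_real (leading z) powr of_real \<sigma>) * \<psi> z" for z
  have hm: "h \<in> borel_measurable borel" unfolding h_def by measurable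
  have flat: "flat_part (of_real \<sigma>) = (LINT z|lborel. indicator quadrant z *\<^sub>R h z)"
    unfolding flat_part_def
  proof (intro Bochner_Integration.integral_cong refl)
    fix z :: "real \<times> real"
    show "indicator usquare z *\<^sub>R ((complex_of_real (leading z * (1 + ratio z)) powr of_real \<sigma> - complex_of_real (leading z) powr of_real \<sigma>) * \<psi> z)
      = indicator quadrant z *\<^sub>R h z"
    proof (cases "z \<in> usquare")
      case True
      then have "z \<in> quadrant" by auto
      then show ?thesis using True by (simp add: h_def)
    next
      case False
      then show ?thesis
        using amplitude_support[of z] by (cases z) (auto simp: h_def indicator_def)
    qed
  qed
  define A where "A = \<tau> powr (real b * \<sigma> / p + 1 / p - 1)"
  have pt: "(indicator quadrant w * (1 * d * fst w powr (d - 1) * (l * 1 * snd w powr (1 - 1))))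
            *\<^sub>R h (1 * fst w powr d, l * snd w powr 1) = A *\<^sub>R rescaled_integrand \<tau> w" for w
  proof (cases "w \<in> quadrant")
    case True
    obtain u v where uv: "w = (u, v)" "u > 0" "v > 0" using True by auto
    define z where "z = (u powr d, l * v)"
    have z: "fst z > 0" "snd z > 0" using uv l by (auto simp: z_def)
    define X where "X = blowup_ratio w powr d"
    have lead: "leading z powr \<sigma> = u powr (1 - d) * (\<tau> powr (real b * \<sigma> / p) * v powr (real b * \<sigma>))"
    proof -
      have "(u powr d) powr (real a * \<sigma>) = u powr (1 - d)"
      proof -
        have "d * (real a * \<sigma>) = 1 - d" using a2 \<tau> by (simp add: d_def \<sigma>_def field_simps)
        then show ?thesis by (simp only: powr_powr)
      qed
      moreover have "(l * v) powr (real b * \<sigma>) = \<tau> powr (real b * \<sigma> / p) * v powr (real b * \<sigma>)"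
        using uv l by (simp add: l_def powr_mult powr_powr)
      ultimately show ?thesis
        using leading_powr[OF z, of \<sigma>] by (simp add: z_def)
    qed
    have rat: "ratio z = X"
    proof -
      have "(l * v) powr (- p) = d * v powr (- p)"
        using uv l p0 \<tau> by (simp add: l_def d_def powr_mult powr_powr powr_minus field_simps)
      moreover have "(u powr d) ^ q = u powr (d * real q)"
        using uv by (simp add: powr_powr flip: powr_realpow)
      ultimately have "ratio z = exp (- (d * v powr (-p))) * u powr (- (d * real q))"
        using uv l by (simp add: ratio_def z_def flat_exp_pos powr_minus_divide)
      also have "\<dots> = exp (- (v powr (-p))) powr d * u powr (- real q * d)"
        by (simp add: exp_powr_real mult.commute)
      also have "\<dots> = X"
        by (simp add: X_def blowup_ratio_def uv powr_mult powr_powr)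
      finally show ?thesis .
    qed
    have X: "X > 0" using blowup_ratio_pos[OF True] by (simp add: X_def)
    have "h z = complex_of_real ((leading z * (1 + X)) powr \<sigma> - leading z powr \<sigma>) * \<psi> z"
      using leading_pos[OF z] X by (simp add: h_def rat powr_of_real flip: of_real_add of_real_mult)
    also have "(leading z * (1 + X)) powr \<sigma> - leading z powr \<sigma> = leading z powr \<sigma> * ((1 + X) powr \<sigma> - 1)"
      by (simp only: powr_mult right_diff_distrib mult_1_right)
    finally have hz: "h z = complex_of_real (leading z powr \<sigma> * ((1 + X) powr \<sigma> - 1)) * \<psi> z" .
    have u1: "u powr (d - 1) * u powr (1 - d) = 1"
      using uv by (simp flip: powr_add)
    have A: "d * l * \<tau> powr (real b * \<sigma> / p) = A"
      using \<tau> by (simp add: A_def d_def l_def powr_add powr_diff)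
    have "(d * u powr (d - 1) * l) * (leading z powr \<sigma> * ((1 + X) powr \<sigma> - 1))
       = (d * l * \<tau> powr (real b * \<sigma> / p)) * (u powr (d - 1) * u powr (1 - d)) * (v powr (real b * \<sigma>) * ((1 + X) powr \<sigma> - 1))"
      unfolding lead by (simp only: mult_ac)
    then have "(d * u powr (d - 1) * l) * (leading z powr \<sigma> * ((1 + X) powr \<sigma> - 1))
       = A * (v powr (real b * \<sigma>) * ((1 + X) powr \<sigma> - 1))"
      unfolding u1 A by simp
    then have "(d * u powr (d - 1) * l) *\<^sub>R h z = A *\<^sub>R (complex_of_real (v powr (real b * \<sigma>) * ((1 + X) powr \<sigma> - 1)) * \<psi> z)"
      unfolding hz scaleR_conv_of_real by (simp only: mult.assoc[symmetric] of_real_mult[symmetric])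
    then show ?thesis
      using uv True by (simp add: rescaled_integrand_def z_def X_def d_def l_def \<sigma>_def mult.assoc)
  qed (simp add: rescaled_integrand_def)
  have fp: "flat_part (of_real \<sigma>) = A *\<^sub>R (LINT w|lborel. rescaled_integrand \<tau> w)"
    unfolding flat
    by (subst integral_quadrant_substitution[OF hm d zero_less_one zero_less_one l]) (simp only: pt integral_scaleR_right)
  have "\<tau> powr (1 + (real b / real a - 1) / p) * A = \<tau> powr (\<tau> * (real b / (real a * p)))"
  proof -
    have "(1 + (real b / real a - 1) / p) + (real b * \<sigma> / p + 1 / p - 1) = \<tau> * (real b / (real a * p))"
      using a2 p0 by (simp add: \<sigma>_def field_simps)
    then show ?thesis by (simp only: A_def powr_add[symmetric])
  qed
  then show ?thesis
    unfolding \<sigma>_def[symmetric] fp scaleR_conv_of_real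
    by (simp only: mult.assoc[symmetric] of_real_mult[symmetric])
qed

text \<open>
  Where \<open>R \<ge> 1\<close> one has \<open>u < 1\<close>, hence the arguments \<open>u^(1/\<tau>)\<close> and \<open>\<tau>^(1/p) v\<close> of the amplitude tend to
  \<open>0\<close>. Where \<open>R < 1\<close> the first argument may go to infinity, but there the other factor tends to \<open>0\<close> and
  the amplitude is bounded.
\<close>

lemma rescaled_integrand_tendsto:
  fixes \<tau> :: "nat \<Rightarrow> real"
  assumes \<tau>: "\<And>n. 0 < \<tau> n" "\<And>n. \<tau> n < 1" "\<tau> \<longlonglongrightarrow> 0"
  shows "(\<lambda>n. rescaled_integrand (\<tau> n) w) \<longlonglongrightarrow> complex_of_real (- blowup_limit w) * \<psi> (0, 0)"
proof (cases "w \<in> quadrant")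
  case True
  obtain u v where uv: "w = (u, v)" "u > 0" "v > 0" using True by auto
  define R where "R = blowup_ratio w"
  have R: "R > 0" using blowup_ratio_pos[OF True] by (simp add: R_def)
  define \<sigma> where "\<sigma> n = (\<tau> n - 1) / real a" for n
  have \<sigma>: "\<sigma> \<longlonglongrightarrow> - 1 / real a"
    unfolding \<sigma>_def using \<tau>(3) a2 by (auto intro!: tendsto_eq_intros)
  have inf: "filterlim (\<lambda>n. 1 / \<tau> n) at_top sequentially"
  proof -
    have "\<tau> n \<noteq> 0" for n using \<tau>(1)[of n] by simp
    then have "filterlim \<tau> (at_right 0) sequentially"
      using \<tau> by (auto simp: filterlim_at)
    from filterlim_compose[OF filterlim_inverse_at_top_right this]
    show ?thesis by (simp add: inverse_eq_divide)
  qed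
  have vlim: "(\<lambda>n. v powr (real b * \<sigma> n)) \<longlonglongrightarrow> v powr (real b * (- 1 / real a))"
    using uv by (intro tendsto_intros \<sigma>) auto
  have decay: "(\<lambda>n. y powr (1 / \<tau> n)) \<longlonglongrightarrow> 0" if "0 < y" "y < 1" for y
  proof -
    have "filterlim (\<lambda>n. ln y * (1 / \<tau> n)) at_bot sequentially"
      using that by (intro filterlim_tendsto_neg_mult_at_bot[OF tendsto_const _ inf]) auto
    then have "(\<lambda>n. exp (ln y * (1 / \<tau> n))) \<longlonglongrightarrow> 0"
      by (rule filterlim_compose[OF exp_at_bot])
    then show ?thesis using that by (simp add: powr_def)
  qed
  define Y where "Y n = (1 + R powr (1 / \<tau> n)) powr \<sigma> n - 1" for n
  have eq: "rescaled_integrand (\<tau> n) w = complex_of_real (v powr (real b * \<sigma> n) * Y n)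
      * \<psi> (u powr (1 / \<tau> n), \<tau> n powr (1 / p) * v)" for n
    using uv by (simp add: rescaled_integrand_def Y_def R_def \<sigma>_def)
  show ?thesis
  proof (cases "R < 1")
    case True
    have "(\<lambda>n. (1 + R powr (1 / \<tau> n)) powr \<sigma> n) \<longlonglongrightarrow> (1 + 0) powr (- 1 / real a)"
      by (intro tendsto_powr tendsto_add tendsto_const decay \<sigma>) (use True R in auto)
    then have "Y \<longlonglongrightarrow> 0" unfolding Y_def by (simp add: LIM_zero_iff)
    then have "(\<lambda>n. v powr (real b * \<sigma> n) * Y n) \<longlonglongrightarrow> 0"
      using tendsto_mult[OF vlim] by fastforce
    from tendsto_mult[OF tendsto_rabs[OF this] tendsto_const[of M]]
    have "(\<lambda>n. \<bar>v powr (real b * \<sigma> n) * Y n\<bar> * M) \<longlonglongrightarrow> 0" by simp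
    then have "(\<lambda>n. rescaled_integrand (\<tau> n) w) \<longlonglongrightarrow> 0"
    proof (rule Lim_null_comparison[rotated])
      show "\<forall>\<^sub>F n in sequentially. norm (rescaled_integrand (\<tau> n) w) \<le> \<bar>v powr (real b * \<sigma> n) * Y n\<bar> * M"
        unfolding eq norm_mult norm_of_real by (intro always_eventually allI mult_left_mono amplitude_bound) auto
    qed
    moreover have "blowup_limit w = 0" using True by (simp add: blowup_limit_def R_def)
    ultimately show ?thesis by simp
  next
    case False
    have u1: "u < 1"
    proof (rule ccontr)
      assume "\<not> u < 1"
      then have "u powr (- real q) \<le> 1" using q2 powr_mono[of "- real q" 0 u] by simp
      moreover have "exp (- (v powr (-p))) < 1" using uv by simp
      ultimately have "exp (- (v powr (-p))) * u powr (- real q) < 1 * 1"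
        using uv by (intro mult_less_le_imp_less) auto
      then show False using False by (simp add: R_def blowup_ratio_def uv)
    qed
    have "(\<lambda>n. \<tau> n powr (1 / p)) \<longlonglongrightarrow> 0 powr (1 / p)"
      by (intro tendsto_powr2 tendsto_const \<tau>(3) always_eventually allI less_imp_le[OF \<tau>(1)]) (use p0 in auto)
    then have "(\<lambda>n. (u powr (1 / \<tau> n), \<tau> n powr (1 / p) * v)) \<longlonglongrightarrow> (0, 0)"
      using uv u1 by (intro tendsto_Pair decay) (auto intro!: tendsto_eq_intros)
    then have \<psi>: "(\<lambda>n. \<psi> (u powr (1 / \<tau> n), \<tau> n powr (1 / p) * v)) \<longlonglongrightarrow> \<psi> (0, 0)"
      using amplitude_cont by (rule isCont_tendsto_compose[rotated])
    have Y: "Y \<longlonglongrightarrow> (if R = 1 then 2 powr (- 1 / real a) - 1 else -1)"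
    proof (cases "R = 1")
      case True
      have "(\<lambda>n. 2 powr \<sigma> n) \<longlonglongrightarrow> 2 powr (- 1 / real a)"
        by (intro tendsto_powr tendsto_const \<sigma>) auto
      then show ?thesis using True by (auto simp: Y_def[abs_def] intro!: tendsto_diff)
    next
      case R1: False
      then have R1: "R > 1" using False by simp
      have "(\<lambda>n. (1 + R powr (1 / \<tau> n)) powr \<sigma> n) \<longlonglongrightarrow> 0"
      proof (rule Lim_null_comparison)
        have "(1 + R powr (1 / \<tau> n)) powr \<sigma> n \<le> (R powr (1 / \<tau> n)) powr \<sigma> n" for n
          using R \<tau>(2)[of n] a2 by (intro powr_mono2') (auto simp: \<sigma>_def field_simps)
        \<comment> \<open>The exponent is \<open>\<sigma>/\<tau> = 1/a - 1/(a \<tau>)\<close>.\<close>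
        also have "(R powr (1 / \<tau> n)) powr \<sigma> n = R powr (1 / real a) * ((1 / R) powr (1 / \<tau> n)) powr (1 / real a)" for n
        proof -
          have "1 / \<tau> n * \<sigma> n = 1 / real a + - (1 / \<tau> n * (1 / real a))"
            using \<tau>(1)[of n] a2 by (simp add: \<sigma>_def field_simps)
          then have "R powr (1 / \<tau> n * \<sigma> n) = R powr (1 / real a) * R powr (- (1 / \<tau> n * (1 / real a)))"
            by (simp only: powr_add)
          then show ?thesis using R by (simp only: powr_powr powr_minus_divide powr_divide powr_one_eq_one) 
        qed
        finally show "\<forall>\<^sub>F n in sequentially. norm ((1 + R powr (1 / \<tau> n)) powr \<sigma> n)
            \<le> R powr (1 / real a) * ((1 / R) powr (1 / \<tau> n)) powr (1 / real a)"
          by (intro always_eventually allI) simp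
        have "(\<lambda>n. ((1 / R) powr (1 / \<tau> n)) powr (1 / real a)) \<longlonglongrightarrow> 0 powr (1 / real a)"
          using R1 a2 by (intro tendsto_powr2 tendsto_const decay) auto
        then show "(\<lambda>n. R powr (1 / real a) * ((1 / R) powr (1 / \<tau> n)) powr (1 / real a)) \<longlonglongrightarrow> 0"
          using tendsto_mult[OF tendsto_const[of "R powr (1 / real a)"]] by fastforce
      qed
      then have "Y \<longlonglongrightarrow> 0 - 1" unfolding Y_def by (intro tendsto_diff tendsto_const)
      then show ?thesis using R1 by simp
    qed
    have "(\<lambda>n. rescaled_integrand (\<tau> n) w) \<longlonglongrightarrow> complex_of_real
       (v powr (real b * (- 1 / real a)) * (if R = 1 then 2 powr (- 1 / real a) - 1 else -1)) * \<psi> (0, 0)"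
      unfolding eq by (intro tendsto_mult tendsto_of_real vlim Y \<psi>)
    moreover have "v powr (real b * (- 1 / real a)) * (if R = 1 then 2 powr (- 1 / real a) - 1 else -1) = - blowup_limit w"
      using uv False by (auto simp: blowup_limit_def R_def right_diff_distrib)
    ultimately show ?thesis by (simp only:)
  qed
qed (simp add: rescaled_integrand_def blowup_limit_def)

text \<open>
  Dominated convergence; the leftover factor \<open>\<tau>^(\<tau> b/(a p))\<close> tends to \<open>1\<close>.
\<close>

lemma flat_part_asymptotics:
  fixes \<tau> :: "nat \<Rightarrow> real"
  assumes \<tau>: "\<And>n. 0 < \<tau> n" "\<And>n. \<tau> n < (1 - real a / real b) / 2" "\<tau> \<longlonglongrightarrow> 0"
  shows "(\<lambda>n. complex_of_real (\<tau> n powr (1 + (real b / real a - 1) / p)) * flat_part (complex_of_real ((\<tau> n - 1) / real a)))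
     \<longlonglongrightarrow> - (complex_of_real (LINT w|lborel. blowup_limit w) * \<psi> (0, 0))"
proof -
  have "(1 - real a / real b) / 2 < 1" using ab a2 by (simp add: field_simps)
  then have \<tau>1: "\<tau> n < 1" for n using \<tau>(2)[of n] by linarith
  have "(\<lambda>n. LINT w|lborel. rescaled_integrand (\<tau> n) w)
     \<longlonglongrightarrow> (LINT w|lborel. complex_of_real (- blowup_limit w) * \<psi> (0, 0))"
  proof (rule integral_dominated_convergence)
    show "integrable lborel (\<lambda>w. M * blowup_majorant w)"
      using blowup_majorant_integrable by simp
    show "AE w in lborel. (\<lambda>n. rescaled_integrand (\<tau> n) w) \<longlonglongrightarrow> complex_of_real (- blowup_limit w) * \<psi> (0, 0)"
      by (intro AE_I2 rescaled_integrand_tendsto \<tau> \<tau>1)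
    show "AE w in lborel. norm (rescaled_integrand (\<tau> n) w) \<le> M * blowup_majorant w" for n
    proof (rule AE_I2)
      fix w :: "real \<times> real"
      show "norm (rescaled_integrand (\<tau> n) w) \<le> M * blowup_majorant w"
      proof (cases "w \<in> quadrant")
        case True
        have "norm (rescaled_integrand (\<tau> n) w)
           = (snd w powr (real b * ((\<tau> n - 1) / real a)) * \<bar>(1 + blowup_ratio w powr (1 / \<tau> n)) powr ((\<tau> n - 1) / real a) - 1\<bar>)
             * norm (\<psi> (fst w powr (1 / \<tau> n), \<tau> n powr (1 / p) * snd w))"
          using True by (simp add: rescaled_integrand_def norm_mult abs_mult del: of_real_mult of_real_diff of_real_power of_real_add)
        also have "\<dots> \<le> blowup_majorant w * M"
          using blowup_integrand_bound[OF True \<tau>(1,2)] amplitude_bound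
          by (intro mult_mono blowup_majorant_nonneg) auto
        finally show ?thesis by (simp add: mult.commute)
      next
        case False
        show ?thesis using False M_nonneg blowup_majorant_nonneg[of w] by (simp add: rescaled_integrand_def)
      qed
    qed
  qed measurable
  moreover have "(LINT w|lborel. complex_of_real (- blowup_limit w) * \<psi> (0, 0))
      = - (complex_of_real (LINT w|lborel. blowup_limit w) * \<psi> (0, 0))"
    by (simp flip: integral_complex_of_real)
  ultimately have 1: "(\<lambda>n. LINT w|lborel. rescaled_integrand (\<tau> n) w)
     \<longlonglongrightarrow> - (complex_of_real (LINT w|lborel. blowup_limit w) * \<psi> (0, 0))" by simp
  have "\<tau> n \<noteq> 0" for n using \<tau>(1)[of n] by simp
  then have "filterlim \<tau> (at_right 0) sequentially"
    using \<tau> by (auto simp: filterlim_at)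
  moreover have "((\<lambda>t. t powr (t * (real b / (real a * p)))) \<longlongrightarrow> 1) (at_right 0)"
  proof -
    have "((\<lambda>t::real. t * ln t) \<longlongrightarrow> 0) (at_right 0)" by real_asymp
    then have "((\<lambda>t. exp (real b / (real a * p) * (t * ln t))) \<longlongrightarrow> exp (real b / (real a * p) * 0)) (at_right 0)"
      by (intro tendsto_intros)
    then have "((\<lambda>t. exp (real b / (real a * p) * (t * ln t))) \<longlongrightarrow> 1) (at_right 0)" by simp
    then show ?thesis
      by (rule Lim_transform_eventually)
         (auto simp: eventually_at_right_less powr_def mult_ac intro!: eventually_mono[OF eventually_at_right_less])
  qed
  ultimately have "(\<lambda>n. \<tau> n powr (\<tau> n * (real b / (real a * p)))) \<longlonglongrightarrow> 1"
    using filterlim_compose by blast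
  then have "(\<lambda>n. complex_of_real (\<tau> n powr (\<tau> n * (real b / (real a * p)))) * (LINT w|lborel. rescaled_integrand (\<tau> n) w))
     \<longlonglongrightarrow> complex_of_real 1 * - (complex_of_real (LINT w|lborel. blowup_limit w) * \<psi> (0, 0))"
    by (intro tendsto_mult tendsto_of_real 1)
  then show ?thesis by (simp only: flat_part_rescaled[OF \<tau>(1) \<tau>1] of_real_1 mult_1_left)
qed

end

section \<open>No meromorphic extension past the boundary point\<close>

context flat_amplitude
begin

abbreviation \<kappa> :: real where
  "\<kappa> \<equiv> (real b / real a - 1) / p"

lemma kappa_pos: "\<kappa> > 0"
  using ratio_ba p0 by simp

lemma real_point_in_half_plane: "0 < \<tau> \<Longrightarrow> complex_of_real ((\<tau> - 1) / real a) \<in> half_plane"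
  using a2 by (simp add: field_simps)

lemma coeff_mellin_growth:
  assumes "0 < \<tau>"
  shows "norm (coeff_mellin k (complex_of_real ((\<tau> - 1) / real a))) \<le> M / \<tau>"
proof -
  let ?s = "complex_of_real ((\<tau> - 1) / real a)"
  have i: "has_bochner_integral lborel (\<lambda>x. M * (indicator {0<..<1} x * x powr (real a * Re ?s))) (M * (1 / \<tau>))"
    using has_bochner_integral_powr_unit[of "\<tau> - 1"] assms a2 by (intro has_bochner_integral_mult_right) auto
  have "norm (coeff_mellin k ?s) \<le> (LINT x|lborel. M * (indicator {0<..<1} x * x powr (real a * Re ?s)))"
    unfolding coeff_mellin_def
    using i coeff_mellin_bound[of "Re ?s" ?s, OF order_refl]
    by (intro norm_lebesgue_integral_le coeff_mellin_integrable real_point_in_half_plane[OF assms])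
       (simp_all only: has_bochner_integral_iff)
  also have "\<dots> = M / \<tau>" using i by (simp add: has_bochner_integral_iff)
  finally show ?thesis .
qed

lemma remainder_part_growth:
  assumes "0 < \<tau>" "\<tau> < 1"
  shows "norm (remainder_part (complex_of_real ((\<tau> - 1) / real a))) \<le> M / \<tau>"
proof -
  let ?s = "complex_of_real ((\<tau> - 1) / real a)"
  have "has_bochner_integral lborel (\<lambda>z :: real \<times> real. (indicator {0<..<1} (fst z) * fst z powr (\<tau> - 1)) * indicator {0<..<1} (snd z))
    (1 / \<tau>)"
    using has_bochner_integral_product[of "\<lambda>x. indicator {0<..<1} x * x powr (\<tau> - 1)" "indicator {0<..<1}"]
      has_bochner_integral_powr_unit[of "\<tau> - 1"] assms by (simp add: has_bochner_integral_iff)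
  then have "has_bochner_integral lborel (\<lambda>z :: real \<times> real. indicator usquare z * fst z powr (\<tau> - 1)) (1 / \<tau>)"
    by (rule has_bochner_integral_cong[THEN iffD1, rotated -1]) (auto simp: indicator_def)
  then have i: "has_bochner_integral lborel (\<lambda>z. M * (indicator usquare z * fst z powr (real a * Re ?s))) (M * (1 / \<tau>))"
    using a2 by (intro has_bochner_integral_mult_right) auto
  have t: "- 1 / real a < Re ?s" "Re ?s \<le> 0" using assms a2 by (auto simp: field_simps)
  have "norm (remainder_part ?s) \<le> (LINT z|lborel. M * (indicator usquare z * fst z powr (real a * Re ?s)))"
    unfolding remainder_part_def
    using i remainder_part_bound[OF t order_refl]
    by (intro norm_lebesgue_integral_le remainder_part_integrable real_point_in_half_plane[OF assms(1)])
       (simp_all only: has_bochner_integral_iff)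
  also have "\<dots> = M / \<tau>" using i by (simp add: has_bochner_integral_iff)
  finally show ?thesis .
qed

lemma powr_null_sequence:
  fixes \<tau> :: "nat \<Rightarrow> real"
  assumes "\<And>n. 0 < \<tau> n" "\<tau> \<longlonglongrightarrow> 0" "y > 0"
  shows "(\<lambda>n. \<tau> n powr y) \<longlonglongrightarrow> 0"
proof -
  have "(\<lambda>n. \<tau> n powr y) \<longlonglongrightarrow> 0 powr y"
    by (intro tendsto_powr2 tendsto_const always_eventually allI less_imp_le[OF assms(1)] assms(2,3))
  then show ?thesis by simp
qed

text \<open>
  The denominator is \<open>(k + 1 - b/a) + (b/a) \<tau>\<close>. It stays away from \<open>0\<close> unless \<open>k + 1 = b/a\<close>, where it
  costs one more power of \<open>\<tau>\<close>; for even \<open>k\<close> this is the case in which \<open>b/a\<close> is an odd integer and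
  \<open>\<kappa> > 1\<close>.
\<close>

lemma polar_term_negligible:
  fixes \<tau> :: "nat \<Rightarrow> real"
  assumes \<tau>: "\<And>n. 0 < \<tau> n" "\<tau> \<longlonglongrightarrow> 0"
    and odd: "\<And>j::int. odd j \<Longrightarrow> real b / real a = of_int j \<Longrightarrow> \<kappa> > 1"
  shows "(\<lambda>n. complex_of_real (\<tau> n powr (1 + \<kappa>)) * (coeff_mellin k (complex_of_real ((\<tau> n - 1) / real a))
           / (of_nat b * complex_of_real ((\<tau> n - 1) / real a) + of_nat k + 1))) \<longlonglongrightarrow> 0"
proof (cases "odd k")
  case True
  then show ?thesis by (simp add: coeff_mellin_def coeff_odd)
next
  case False
  define D where "D n = (real k + 1 - real b / real a) + real b / real a * \<tau> n" for n
  have D: "of_nat b * complex_of_real ((\<tau> n - 1) / real a) + of_nat k + 1 = complex_of_real (D n)" for n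
  proof -
    have "D n = real b * ((\<tau> n - 1) / real a) + real k + 1" using a2 by (simp add: D_def field_simps)
    then show ?thesis by simp
  qed
  have bd: "norm (complex_of_real (\<tau> n powr (1 + \<kappa>)) * (coeff_mellin k (complex_of_real ((\<tau> n - 1) / real a))
           / (of_nat b * complex_of_real ((\<tau> n - 1) / real a) + of_nat k + 1))) \<le> \<tau> n powr \<kappa> * M / \<bar>D n\<bar>" for n
  proof -
    have "norm (complex_of_real (\<tau> n powr (1 + \<kappa>)) * (coeff_mellin k (complex_of_real ((\<tau> n - 1) / real a))
           / complex_of_real (D n))) \<le> \<tau> n powr (1 + \<kappa>) * (M / \<tau> n / \<bar>D n\<bar>)"
      unfolding norm_mult norm_divide norm_of_real abs_of_nonneg[OF powr_ge_zero]
      using coeff_mellin_growth[OF \<tau>(1)[of n], of k] by (intro mult_left_mono divide_right_mono) auto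
    also have "\<dots> = \<tau> n powr \<kappa> * M / \<bar>D n\<bar>"
      using \<tau>(1)[of n] by (simp add: powr_add)
    finally show ?thesis unfolding D .
  qed
  have "(\<lambda>n. \<tau> n powr \<kappa> * M / \<bar>D n\<bar>) \<longlonglongrightarrow> 0"
  proof (cases "real k + 1 = real b / real a")
    case True
    have "\<kappa> > 1"
    proof (rule odd)
      show "odd (int k + 1)" using False by simp
      show "real b / real a = of_int (int k + 1)" using True by simp
    qed
    then have "(\<lambda>n. \<tau> n powr (\<kappa> - 1) * (M * real a / real b)) \<longlonglongrightarrow> 0 * (M * real a / real b)"
      by (intro tendsto_mult tendsto_const powr_null_sequence \<tau>) auto
    moreover have "\<tau> n powr \<kappa> * M / \<bar>D n\<bar> = \<tau> n powr (\<kappa> - 1) * (M * real a / real b)" for n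
      using \<tau>(1)[of n] True ab a2 by (simp add: D_def powr_diff abs_mult mult_ac)
    ultimately show ?thesis by simp
  next
    case False
    have "D \<longlonglongrightarrow> (real k + 1 - real b / real a) + real b / real a * 0"
      unfolding D_def by (intro tendsto_intros \<tau>)
    then have "(\<lambda>n. \<tau> n powr \<kappa> * M / \<bar>D n\<bar>) \<longlonglongrightarrow> 0 * M / \<bar>(real k + 1 - real b / real a) + real b / real a * 0\<bar>"
      using False by (intro tendsto_divide tendsto_mult tendsto_const tendsto_rabs powr_null_sequence \<tau> kappa_pos) auto
    then show ?thesis by simp
  qed
  then show ?thesis
    by (rule Lim_null_comparison[OF always_eventually, rotated]) (use bd in blast)
qed

lemma continued_zeta_asymptotics:
  fixes \<tau> :: "nat \<Rightarrow> real"
  assumes \<tau>: "\<And>n. 0 < \<tau> n" "\<And>n. \<tau> n < (1 - real a / real b) / 2" "\<tau> \<longlonglongrightarrow> 0"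
    and odd: "\<And>j::int. odd j \<Longrightarrow> real b / real a = of_int j \<Longrightarrow> \<kappa> > 1"
  shows "(\<lambda>n. complex_of_real (\<tau> n powr (1 + \<kappa>)) * continued_zeta (complex_of_real ((\<tau> n - 1) / real a)))
     \<longlonglongrightarrow> - (complex_of_real (LINT w|lborel. blowup_limit w) * \<psi> (0, 0))"
proof -
  have "(1 - real a / real b) / 2 < 1" using ab a2 by (simp add: field_simps)
  then have \<tau>1: "\<tau> n < 1" for n using \<tau>(2)[of n] by linarith
  let ?s = "\<lambda>n. complex_of_real ((\<tau> n - 1) / real a)"
  have 1: "(\<lambda>n. \<Sum>k<b. complex_of_real (\<tau> n powr (1 + \<kappa>)) * (coeff_mellin k (?s n)
           / (of_nat b * ?s n + of_nat k + 1))) \<longlonglongrightarrow> (\<Sum>k<b. 0)"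
    by (intro tendsto_sum polar_term_negligible \<tau> odd)
  have 2: "(\<lambda>n. complex_of_real (\<tau> n powr (1 + \<kappa>)) * remainder_part (?s n)) \<longlonglongrightarrow> 0"
  proof (rule Lim_null_comparison[OF always_eventually], rule allI)
    fix n
    have "norm (complex_of_real (\<tau> n powr (1 + \<kappa>)) * remainder_part (?s n)) \<le> \<tau> n powr (1 + \<kappa>) * (M / \<tau> n)"
      unfolding norm_mult norm_of_real abs_of_nonneg[OF powr_ge_zero]
      using remainder_part_growth[OF \<tau>(1) \<tau>1, of n] by (intro mult_left_mono) auto
    also have "\<dots> = \<tau> n powr \<kappa> * M" using \<tau>(1)[of n] by (simp add: powr_add)
    finally show "norm (complex_of_real (\<tau> n powr (1 + \<kappa>)) * remainder_part (?s n)) \<le> \<tau> n powr \<kappa> * M" .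
  next
    have "(\<lambda>n. \<tau> n powr \<kappa> * M) \<longlonglongrightarrow> 0 * M"
      by (intro tendsto_mult tendsto_const powr_null_sequence \<tau> kappa_pos)
    then show "(\<lambda>n. \<tau> n powr \<kappa> * M) \<longlonglongrightarrow> 0" by simp
  qed
  show ?thesis
    using tendsto_add[OF tendsto_add[OF 1 2] flat_part_asymptotics[OF \<tau>]]
    by (simp add: continued_zeta_def distrib_left sum_distrib_left)
qed

text \<open>
  By the identity theorem the two functions agree on the half plane off a discrete set; such a set
  may contain some points of the real axis but never a whole interval.
\<close>

lemma meromorphic_extension_agrees:
  assumes F: "F meromorphic_on half_plane" and eq: "\<And>s. Re s > 0 \<Longrightarrow> F s = continued_zeta s"
    and e: "e > 0"
  shows "\<exists>\<tau>. 0 < \<tau> \<and> \<tau> < e \<and> F (complex_of_real ((\<tau> - 1) / real a)) = continued_zeta (complex_of_real ((\<tau> - 1) / real a))"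
proof -
  let ?D = "\<lambda>s. F s - continued_zeta s"
  have conn: "connected half_plane" by (intro convex_connected convex_halfspace_Re_gt)
  have "?D meromorphic_on half_plane"
    by (intro meromorphic_on_diff F continued_zeta_meromorphic)
  then have alt: "(\<forall>\<^sub>F z in cosparse half_plane. ?D z = 0) \<or> (\<forall>\<^sub>F z in cosparse half_plane. ?D z \<noteq> 0)"
    by (rule meromorphic_imp_constant_or_avoid[OF _ half_plane_open conn])
  note cosparse_iff = eventually_cosparse_open_eq[OF half_plane_open]
  have nz: "\<not> (\<forall>\<^sub>F z in cosparse half_plane. ?D z \<noteq> 0)"
  proof
    assume "\<forall>\<^sub>F z in cosparse half_plane. ?D z \<noteq> 0"
    then have "\<forall>\<^sub>F z in at 1. ?D z \<noteq> 0"
      unfolding cosparse_iff using Re_pos_imp_half_plane[of 1] by (metis one_complex.sel(1) zero_less_one)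
    moreover have "\<forall>\<^sub>F z in at (1::complex). z \<in> {s. Re s > 0}"
      by (intro eventually_at_in_open' open_halfspace_Re_gt) auto
    ultimately have "\<forall>\<^sub>F z in at (1::complex). False"
      by eventually_elim (use eq in auto)
    then show False by simp
  qed
  have ev: "\<forall>\<^sub>F z in at s. ?D z = 0" if "s \<in> half_plane" for s
    using alt nz that unfolding cosparse_iff by blast
  obtain d where d: "d > 0"
    and deq: "\<And>z. z \<noteq> complex_of_real ((e / 2 - 1) / real a) \<Longrightarrow> dist z (complex_of_real ((e / 2 - 1) / real a)) < d \<Longrightarrow> ?D z = 0"
    using ev[OF real_point_in_half_plane[of "e / 2"]] e by (auto simp: eventually_at)
  define m where "m = min d e / 4"
  have m: "m > 0" "m < d" "m < e / 2" using d e by (auto simp: m_def)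
  define \<tau> where "\<tau> = e / 2 + m"
  have diff: "complex_of_real ((\<tau> - 1) / real a) - complex_of_real ((e / 2 - 1) / real a) = complex_of_real (m / real a)"
    unfolding of_real_diff[symmetric] by (simp add: \<tau>_def field_simps flip: diff_divide_distrib)
  have "m / real a \<noteq> 0" "m / real a < d"
  proof -
    have "m / real a \<le> m / 1" using a2 m by (intro divide_left_mono) auto
    then show "m / real a < d" using m by simp
    show "m / real a \<noteq> 0" using m a2 by simp
  qed
  then have "?D (complex_of_real ((\<tau> - 1) / real a)) = 0"
  proof (intro deq)
    assume "m / real a \<noteq> 0"
    then show "complex_of_real ((\<tau> - 1) / real a) \<noteq> complex_of_real ((e / 2 - 1) / real a)"
      using diff by (metis diff_self of_real_eq_0_iff)
    assume "m / real a < d"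
    then show "dist (complex_of_real ((\<tau> - 1) / real a)) (complex_of_real ((e / 2 - 1) / real a)) < d"
      using m a2 unfolding dist_norm diff norm_of_real by simp
  qed
  then show ?thesis using m e by (intro exI[of _ \<tau>]) (auto simp: \<tau>_def)
qed

text \<open>
  A sequence of real points tending from the right to \<open>-1/a\<close> along which the extension coincides with
  \<open>continued_zeta\<close> transfers the growth rate to the extension.
\<close>

lemma meromorphic_extension_imp_integer:
  assumes F: "F meromorphic_on half_plane \<union> V" and V: "complex_of_real (- 1 / real a) \<in> V"
    and eq: "\<And>s. Re s > 0 \<Longrightarrow> F s = quadrant_zeta s"
    and \<psi>0: "\<psi> (0, 0) \<noteq> 0"
    and odd: "\<And>j::int. odd j \<Longrightarrow> real b / real a = of_int j \<Longrightarrow> \<kappa> > 1"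
  shows "\<kappa> \<in> \<int>"
proof -
  define e0 where "e0 = (1 - real a / real b) / 2"
  have e0: "e0 > 0" using ab a2 by (simp add: e0_def field_simps)
  have FH: "F meromorphic_on half_plane" and F0: "F meromorphic_on {complex_of_real (- 1 / real a)}"
    using F V by (auto intro: meromorphic_on_subset)
  have "\<exists>\<tau>. 0 < \<tau> \<and> \<tau> < min e0 (1 / (real n + 1)) \<and>
      F (complex_of_real ((\<tau> - 1) / real a)) = continued_zeta (complex_of_real ((\<tau> - 1) / real a))" for n :: nat
    by (rule meromorphic_extension_agrees[OF FH]) (use eq continued_zeta_eq e0 in auto)
  then obtain \<tau> where \<tau>: "\<And>n. 0 < \<tau> n" "\<And>n. \<tau> n < min e0 (1 / (real n + 1))"
    and Feq: "\<And>n. F (complex_of_real ((\<tau> n - 1) / real a)) = continued_zeta (complex_of_real ((\<tau> n - 1) / real a))"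
    by metis
  have \<tau>0: "\<tau> \<longlonglongrightarrow> 0"
  proof (rule Lim_null_comparison[OF always_eventually], rule allI)
    show "norm (\<tau> n) \<le> 1 / (real n + 1)" for n using \<tau>[of n] by simp
    show "(\<lambda>n. 1 / (real n + 1)) \<longlonglongrightarrow> 0" by real_asymp
  qed
  have \<tau>e: "\<tau> n < (1 - real a / real b) / 2" for n using \<tau>(2)[of n] by (simp add: e0_def)
  define s where "s n = complex_of_real ((\<tau> n - 1) / real a)" for n
  define L where "L = (LINT w|lborel. blowup_limit w)"
  have L: "L > 0" using blowup_limit_integral_pos by (simp add: L_def)
  have lim: "(\<lambda>n. norm (complex_of_real (\<tau> n powr (1 + \<kappa>)) * F (s n))) \<longlonglongrightarrow> norm (- (complex_of_real L * \<psi> (0, 0)))"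
    unfolding s_def Feq L_def by (intro tendsto_norm continued_zeta_asymptotics \<tau>(1) \<tau>e \<tau>0 odd)
  have diff: "s n - complex_of_real (- 1 / real a) = complex_of_real (\<tau> n / real a)" for n
    by (simp add: s_def diff_divide_distrib)
  have nd: "norm (s n - complex_of_real (- 1 / real a)) = \<tau> n / real a" for n
    unfolding diff norm_of_real using \<tau>(1)[of n] by simp
  have "1 + \<kappa> \<in> \<int>"
  proof (rule meromorphic_integer_exponent[OF F0, of s])
    have "(\<lambda>n. s n - complex_of_real (- 1 / real a)) \<longlonglongrightarrow> 0"
      unfolding tendsto_norm_zero_iff[symmetric, of "\<lambda>n. s n - complex_of_real (- 1 / real a)"] nd
      using tendsto_divide[OF \<tau>0 tendsto_const[of "real a"]] a2 by simp
    then show "s \<longlonglongrightarrow> complex_of_real (- 1 / real a)" by (simp only: LIM_zero_iff)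
    show "s n \<noteq> complex_of_real (- 1 / real a)" for n
      using nd[of n] \<tau>(1)[of n] a2 by auto
    have "(\<lambda>n. real a powr (- (1 + \<kappa>)) * norm (complex_of_real (\<tau> n powr (1 + \<kappa>)) * F (s n)))
        \<longlonglongrightarrow> real a powr (- (1 + \<kappa>)) * norm (- (complex_of_real L * \<psi> (0, 0)))"
      by (intro tendsto_mult tendsto_const lim)
    moreover have "norm (s n - complex_of_real (- 1 / real a)) powr (1 + \<kappa>) * norm (F (s n))
        = real a powr (- (1 + \<kappa>)) * norm (complex_of_real (\<tau> n powr (1 + \<kappa>)) * F (s n))" for n
      unfolding nd norm_mult norm_of_real powr_minus_divide using \<tau>(1)[of n] by (simp add: powr_divide)
    ultimately show "(\<lambda>n. norm (s n - complex_of_real (- 1 / real a)) powr (1 + \<kappa>) * norm (F (s n)))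
        \<longlonglongrightarrow> real a powr (- (1 + \<kappa>)) * norm (- (complex_of_real L * \<psi> (0, 0)))"
      by (simp only:)
    show "real a powr (- (1 + \<kappa>)) * norm (- (complex_of_real L * \<psi> (0, 0))) \<noteq> 0"
      using L \<psi>0 a2 by (simp add: norm_mult)
  qed
  then have "(1 + \<kappa>) - 1 \<in> \<int>" by (intro Ints_diff) auto
  then show ?thesis by simp
qed

end

section \<open>Vertical Taylor expansion of test functions\<close>

lemma smooth_differentiable: "smooth \<phi> \<Longrightarrow> \<phi> differentiable (at z)"
  unfolding smooth_def by (metis Ck.simps(2))

lemma smooth_frechet_derivative: "smooth \<phi> \<Longrightarrow> smooth (\<lambda>z. frechet_derivative \<phi> (at z) v)"
  unfolding smooth_def by (metis Ck.simps(2))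

lemma smooth_continuous: "smooth \<phi> \<Longrightarrow> continuous_on UNIV \<phi>"
  unfolding smooth_def by (metis Ck.simps(1))

primrec vertical_derivative :: "nat \<Rightarrow> (real \<times> real \<Rightarrow> complex) \<Rightarrow> real \<times> real \<Rightarrow> complex" where
  "vertical_derivative 0 \<phi> = \<phi>"
| "vertical_derivative (Suc k) \<phi> = (\<lambda>z. frechet_derivative (vertical_derivative k \<phi>) (at z) (0, 1))"

lemma smooth_vertical_derivative: "smooth \<phi> \<Longrightarrow> smooth (vertical_derivative k \<phi>)"
  by (induction k) (auto intro: smooth_frechet_derivative)

lemma vertical_derivative_outside:
  assumes K: "closed K" and 0: "\<And>z. z \<notin> K \<Longrightarrow> \<phi> z = 0" and z: "z \<notin> K"
  shows "vertical_derivative k \<phi> z = 0"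
  using z
proof (induction k arbitrary: z)
  case 0
  then show ?case using assms by simp
next
  case (Suc k)
  have "((\<lambda>_. 0) has_derivative (\<lambda>_. 0)) (at z)" by simp
  then have "(vertical_derivative k \<phi> has_derivative (\<lambda>_. 0)) (at z)"
    by (rule has_derivative_transform_within_open[of _ _ _ _ "- K"])
       (use K Suc in auto)
  then have "frechet_derivative (vertical_derivative k \<phi>) (at z) = (\<lambda>_. 0)"
    by (rule frechet_derivative_at[symmetric])
  then show ?case by simp
qed

lemma vertical_derivative_bounded:
  assumes s: "smooth \<phi>" and K: "compact K" and 0: "\<And>z. z \<notin> K \<Longrightarrow> \<phi> z = 0"
  shows "\<exists>B\<ge>0. \<forall>z. norm (vertical_derivative k \<phi> z) \<le> B"
proof -
  have "compact (vertical_derivative k \<phi> ` K)"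
    using smooth_continuous[OF smooth_vertical_derivative[OF s]] K
    by (intro compact_continuous_image) (auto intro: continuous_on_subset)
  then obtain B where B: "\<And>z. z \<in> K \<Longrightarrow> norm (vertical_derivative k \<phi> z) \<le> B"
    using compact_imp_bounded bounded_iff by (metis imageI)
  have "norm (vertical_derivative k \<phi> z) \<le> max 0 B" for z
    using B[of z] vertical_derivative_outside[OF compact_imp_closed[OF K] 0, where z = z and k = k] by (cases "z \<in> K") auto
  then show ?thesis by (intro exI[of _ "max 0 B"]) auto
qed

lemma vertical_derivative_has_derivative:
  assumes "smooth \<phi>"
  shows "((\<lambda>y. vertical_derivative k \<phi> (x, y)) has_vector_derivative vertical_derivative (Suc k) \<phi> (x, y)) (at y)"
proof -
  let ?g = "vertical_derivative k \<phi>"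
  have d: "(?g has_derivative frechet_derivative ?g (at (x, y))) (at (x, y))"
    using smooth_differentiable[OF smooth_vertical_derivative[OF assms]] frechet_derivative_works by blast
  have "((\<lambda>y. (x, y)) has_derivative (\<lambda>h. (0, h))) (at y)"
    by (auto intro!: derivative_eq_intros)
  then have "((\<lambda>y. ?g (x, y)) has_derivative (\<lambda>h. frechet_derivative ?g (at (x, y)) (0, h))) (at y)"
    using d by (rule has_derivative_compose)
  moreover have "(\<lambda>h. frechet_derivative ?g (at (x, y)) (0, h)) = (\<lambda>h. h *\<^sub>R frechet_derivative ?g (at (x, y)) (0, 1))"
  proof
    fix h :: real
    show "frechet_derivative ?g (at (x, y)) (0, h) = h *\<^sub>R frechet_derivative ?g (at (x, y)) (0, 1)"
      using linear_scale[OF has_derivative_linear[OF d], of h "(0, 1)"] by simp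
  qed
  ultimately show ?thesis
    unfolding has_vector_derivative_def vertical_derivative.simps by (simp only:)
qed

text \<open>
  The real Taylor estimate applied to real and imaginary part, whence the factor 2; the
  factorial in the denominator is dropped.
\<close>

lemma vertical_taylor:
  assumes s: "smooth \<phi>" and n: "n > 0" and B: "\<And>z. norm (vertical_derivative n \<phi> z) \<le> B"
  shows "norm (\<phi> (x, y) - (\<Sum>k<n. vertical_derivative k \<phi> (x, 0) * of_real y ^ k / fact k)) \<le> 2 * B * \<bar>y\<bar> ^ n"
proof -
  let ?d = "\<lambda>k y. vertical_derivative k \<phi> (x, y)"
  obtain m where m: "n = Suc m" using n gr0_implies_Suc by blast
  have B0: "B \<ge> 0" using B[of 0] norm_ge_zero order_trans by blast
  have real_part: "\<bar>L (?d 0 y) - (\<Sum>k<n. L (?d k 0) * y ^ k / fact k)\<bar> \<le> B * \<bar>y\<bar> ^ n"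
    if L: "bounded_linear L" "\<And>w. \<bar>L w\<bar> \<le> norm w" for L :: "complex \<Rightarrow> real"
  proof -
    have "norm (L (?d 0 y) - (\<Sum>k\<le>m. L (?d k 0) * (y - 0) ^ k / fact k)) \<le> B * norm (y - 0) ^ Suc m / fact m"
    proof (rule field_Taylor[where S = UNIV and f = "\<lambda>k y. L (?d k y)"])
      show "((\<lambda>y. L (?d i y)) has_field_derivative L (?d (Suc i) t)) (at t within UNIV)" for i t
        using bounded_linear.has_vector_derivative[OF L(1) vertical_derivative_has_derivative[OF s]]
        by (simp add: has_real_derivative_iff_has_vector_derivative)
      show "norm (L (?d (Suc m) t)) \<le> B" for t
        using L(2)[of "?d (Suc m) t"] B[of "(x, t)"] m by simp
    qed auto
    also have "B * norm (y - 0) ^ Suc m / fact m \<le> B * norm (y - 0) ^ Suc m / 1"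
      using B0 by (intro divide_left_mono mult_nonneg_nonneg) (auto simp: fact_ge_1)
    finally show ?thesis by (simp add: m lessThan_Suc_atMost)
  qed
  let ?E = "\<phi> (x, y) - (\<Sum>k<n. ?d k 0 * of_real y ^ k / fact k)"
  have "?d k 0 * of_real y ^ k / fact k = (y ^ k / fact k) *\<^sub>R ?d k 0" for k
    by (simp add: scaleR_conv_of_real)
  then have E: "?E = ?d 0 y - (\<Sum>k<n. (y ^ k / fact k) *\<^sub>R ?d k 0)"
    by simp
  have Re: "Re ?E = Re (?d 0 y) - (\<Sum>k<n. Re (?d k 0) * y ^ k / fact k)"
    and Im: "Im ?E = Im (?d 0 y) - (\<Sum>k<n. Im (?d k 0) * y ^ k / fact k)"
    unfolding E by (simp_all add: mult.commute)
  have "norm ?E \<le> \<bar>Re ?E\<bar> + \<bar>Im ?E\<bar>" by (rule cmod_le)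
  also have "\<dots> \<le> B * \<bar>y\<bar> ^ n + B * \<bar>y\<bar> ^ n"
    unfolding Re Im
    by (intro add_mono real_part bounded_linear_Re bounded_linear_Im abs_Re_le_cmod abs_Im_le_cmod)
  finally show ?thesis by simp
qed

section \<open>Folding the plane onto a quadrant\<close>

lemma lborel_reflect:
  assumes "\<bar>e\<bar> = (1::real)" "\<bar>d\<bar> = (1::real)"
  shows "lborel = distr lborel borel (\<lambda>z. (e * fst z, d * snd z))"
proof -
  let ?c = "\<lambda>j :: real \<times> real. if j = (1, 0) then e else d"
  have "lborel = density (distr lborel borel (\<lambda>x. 0 + (\<Sum>j\<in>Basis. (?c j * (x \<bullet> j)) *\<^sub>R j))) (\<lambda>_. (\<Prod>j\<in>Basis. \<bar>?c j\<bar>))"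
    by (rule lborel_affine_euclidean) (use assms in auto)
  moreover have "0 + (\<Sum>j\<in>Basis. (?c j * (x \<bullet> j)) *\<^sub>R j) = (e * fst x, d * snd x)" for x :: "real \<times> real"
    by (cases x) (simp add: Basis_prod_def)
  moreover have "(\<Prod>j\<in>Basis. \<bar>?c j\<bar>) = 1"
    by (rule prod.neutral) (use assms in auto)
  ultimately show ?thesis by (simp add: density_1)
qed

lemma reflect_measurable:
  "(\<lambda>z :: real \<times> real. (e * fst z, d * snd z)) \<in> borel \<rightarrow>\<^sub>M borel"
  by (intro borel_measurable_continuous_onI continuous_intros)

lemma reflection_invariance:
  fixes h :: "real \<times> real \<Rightarrow> complex"
  assumes "\<bar>e\<bar> = (1::real)" "\<bar>d\<bar> = (1::real)" and h: "integrable lborel h"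
  shows "integrable lborel (\<lambda>z. h (e * fst z, d * snd z))"
    and "(LINT z|lborel. h (e * fst z, d * snd z)) = (LINT z|lborel. h z)"
proof -
  let ?T = "\<lambda>z :: real \<times> real. (e * fst z, d * snd z)"
  have T: "?T \<in> lborel \<rightarrow>\<^sub>M borel" using reflect_measurable by simp
  have hm: "h \<in> borel_measurable borel" using h by auto
  have "integrable (distr lborel borel ?T) h" using h lborel_reflect[OF assms(1,2)] by simp
  then show "integrable lborel (\<lambda>z. h (?T z))" using integrable_distr_eq[OF T hm] by simp
  show "(LINT z|lborel. h (?T z)) = (LINT z|lborel. h z)"
    using integral_distr[OF T hm] lborel_reflect[OF assms(1,2)] by simp
qed

lemma AE_off_axes: "AE z in (lborel :: (real \<times> real) measure). fst z \<noteq> 0 \<and> snd z \<noteq> 0"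
proof -
  have "({0} \<times> UNIV :: (real \<times> real) set) \<in> null_sets lborel" "(UNIV \<times> {0} :: (real \<times> real) set) \<in> null_sets lborel"
    unfolding lborel_prod[symmetric]
    by (auto simp: null_sets_def lborel.emeasure_pair_measure_Times)
  then have "AE z in (lborel :: (real \<times> real) measure). z \<notin> {0} \<times> UNIV" "AE z in (lborel :: (real \<times> real) measure). z \<notin> UNIV \<times> {0}"
    by (auto intro: AE_not_in)
  then show ?thesis by eventually_elim (auto simp: mem_Times_iff)
qed

text \<open>
  Off the axes the plane is the disjoint union of the four images of the quadrant under
  sign changes.
\<close>

lemma integral_fold_quadrant:
  fixes h :: "real \<times> real \<Rightarrow> complex"
  assumes h: "integrable lborel h"
  shows "(LINT z|lborel. h z) = (LINT z|lborel. indicator quadrant z *\<^sub>R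
     (h (fst z, snd z) + h (- fst z, snd z) + h (fst z, - snd z) + h (- fst z, - snd z)))"
proof -
  have Qm: "quadrant \<in> sets lborel" by (auto intro!: borel_open open_Times)
  have int: "integrable lborel (\<lambda>z. indicator quadrant z *\<^sub>R h (e * fst z, d * snd z))"
    if "\<bar>e\<bar> = 1" "\<bar>d\<bar> = 1" for e d
    using integrable_mult_indicator[OF Qm reflection_invariance(1)[OF that h]] .
  have unreflect: "integrable lborel (\<lambda>z. indicator quadrant (e * fst z, d * snd z) *\<^sub>R h z)"
    "(LINT z|lborel. indicator quadrant (e * fst z, d * snd z) *\<^sub>R h z)
        = (LINT z|lborel. indicator quadrant z *\<^sub>R h (e * fst z, d * snd z))"
    if e: "\<bar>e\<bar> = 1" "\<bar>d\<bar> = 1" for e d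
  proof -
    have ee: "e * (e * x) = x" "d * (d * x) = x" for x
      using e by (auto simp: abs_if split: if_splits)
    show "integrable lborel (\<lambda>z. indicator quadrant (e * fst z, d * snd z) *\<^sub>R h z)"
      using reflection_invariance(1)[OF e int[OF e]] by (simp add: ee)
    show "(LINT z|lborel. indicator quadrant (e * fst z, d * snd z) *\<^sub>R h z)
        = (LINT z|lborel. indicator quadrant z *\<^sub>R h (e * fst z, d * snd z))"
      using reflection_invariance(2)[OF e int[OF e]] by (simp add: ee)
  qed
  let ?i = "\<lambda>e d z. indicator quadrant (e * fst z, d * snd z) *\<^sub>R h z"
  have "(LINT z|lborel. h z) = (LINT z|lborel. ?i 1 1 z + ?i (-1) 1 z + ?i 1 (-1) z + ?i (-1) (-1) z)"
  proof (rule integral_cong_AE)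
    show "AE z in lborel. h z = ?i 1 1 z + ?i (-1) 1 z + ?i 1 (-1) z + ?i (-1) (-1) z"
      using AE_off_axes by eventually_elim (auto simp: indicator_def)
    show "(\<lambda>z. ?i 1 1 z + ?i (-1) 1 z + ?i 1 (-1) z + ?i (-1) (-1) z) \<in> borel_measurable lborel"
      by (intro borel_measurable_add borel_measurable_integrable unreflect(1)) auto
  qed (use h in auto)
  also have "\<dots> = (LINT z|lborel. ?i 1 1 z) + (LINT z|lborel. ?i (-1) 1 z) + (LINT z|lborel. ?i 1 (-1) z) + (LINT z|lborel. ?i (-1) (-1) z)"
    using unreflect(1)[of 1 1] unreflect(1)[of "-1" 1] unreflect(1)[of 1 "-1"] unreflect(1)[of "-1" "-1"] by simp
  also have "\<dots> = (LINT z|lborel. indicator quadrant z *\<^sub>R h (1 * fst z, 1 * snd z))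
     + (LINT z|lborel. indicator quadrant z *\<^sub>R h (-1 * fst z, 1 * snd z))
     + (LINT z|lborel. indicator quadrant z *\<^sub>R h (1 * fst z, -1 * snd z))
     + (LINT z|lborel. indicator quadrant z *\<^sub>R h (-1 * fst z, -1 * snd z))"
    by (simp only: unreflect(2) abs_one abs_minus_cancel)
  also have "\<dots> = (LINT z|lborel. indicator quadrant z *\<^sub>R h (1 * fst z, 1 * snd z)
     + indicator quadrant z *\<^sub>R h (-1 * fst z, 1 * snd z)
     + indicator quadrant z *\<^sub>R h (1 * fst z, -1 * snd z)
     + indicator quadrant z *\<^sub>R h (-1 * fst z, -1 * snd z))"
    using int[of 1 1] int[of "-1" 1] int[of 1 "-1"] int[of "-1" "-1"] by simp
  finally show ?thesis by (simp add: scaleR_add_right)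
qed

lemma f_flat_abs:
  assumes "even q" "q \<le> a"
  shows "\<bar>f_flat a b p q (x, y)\<bar> = \<bar>x\<bar> ^ (a - q) * \<bar>y\<bar> ^ b * (\<bar>x\<bar> ^ q + flat_exp p \<bar>y\<bar>)"
proof -
  have "x ^ a = x ^ (a - q) * x ^ q" using assms by (simp flip: power_add)
  then have "f_flat a b p q (x, y) = x ^ (a - q) * y ^ b * (\<bar>x\<bar> ^ q + flat_exp p \<bar>y\<bar>)"
    using assms by (simp add: f_flat_def flat_exp_def power_even_abs algebra_simps)
  moreover have "\<bar>x\<bar> ^ q + flat_exp p \<bar>y\<bar> \<ge> 0" by (simp add: flat_exp_def)
  ultimately show ?thesis by (simp add: abs_mult power_abs)
qed

context flat_phase
begin

lemma f_flat_measurable: "f_flat a b p q \<in> borel_measurable borel"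
proof -
  have "f_flat a b p q = (\<lambda>z. fst z ^ a * snd z ^ b + fst z ^ (a - q) * snd z ^ b * flat_exp p (snd z))"
    by (auto simp: f_flat_def)
  then show ?thesis by simp
qed

lemma local_zeta_integrable:
  assumes q: "even q" and s: "Re s > 0" and \<phi>: "continuous_on UNIV \<phi>"
    and K: "compact K" "K \<subseteq> ball (0, 0) 1" "\<And>z. z \<notin> K \<Longrightarrow> \<phi> z = 0" and B: "\<And>z. norm (\<phi> z) \<le> B"
  shows "integrable lborel (\<lambda>z. complex_of_real \<bar>f_flat a b p q z\<bar> powr s * \<phi> z)"
proof (rule Bochner_Integration.integrable_bound)
  show "integrable lborel (\<lambda>z. 2 powr Re s * B * indicator K z)"
    using K(1) by (intro integrable_mult_right integrable_real_indicator)
      (auto simp: borel_compact dest: emeasure_compact_finite)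
  have [measurable]: "\<phi> \<in> borel_measurable borel" using \<phi> by (rule borel_measurable_continuous_onI)
  note [measurable] = f_flat_measurable
  show "(\<lambda>z. complex_of_real \<bar>f_flat a b p q z\<bar> powr s * \<phi> z) \<in> borel_measurable lborel"
    by measurable
  have B0: "B \<ge> 0" using B[of 0] norm_ge_zero order_trans by blast
  show "AE z in lborel. norm (complex_of_real \<bar>f_flat a b p q z\<bar> powr s * \<phi> z) \<le> norm (2 powr Re s * B * indicator K z)"
  proof (rule AE_I2)
    fix z :: "real \<times> real"
    obtain x y where z: "z = (x, y)" by (cases z)
    show "norm (complex_of_real \<bar>f_flat a b p q z\<bar> powr s * \<phi> z) \<le> norm (2 powr Re s * B * indicator K z)"
    proof (cases "z \<in> K")
      case True
      then have "norm z < 1" using K(2) by (auto simp: subset_eq zero_prod_def[symmetric])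
      then have xy: "\<bar>x\<bar> \<le> 1" "\<bar>y\<bar> \<le> 1"
        using norm_fst_le[of x y] norm_snd_le[of y x] by (auto simp: z)
      have e: "0 \<le> flat_exp p \<bar>y\<bar>" "flat_exp p \<bar>y\<bar> \<le> 1" by (auto simp: flat_exp_def)
      have "\<bar>f_flat a b p q z\<bar> \<le> (1 * 1) * (1 + 1)"
        unfolding z f_flat_abs[OF q qa] using xy e
        by (intro mult_mono add_mono power_le_one) auto
      then have f2: "\<bar>f_flat a b p q z\<bar> \<le> 2" by simp
      have "norm (complex_of_real \<bar>f_flat a b p q z\<bar> powr s) = \<bar>f_flat a b p q z\<bar> powr Re s"
        by (cases "f_flat a b p q z = 0") (auto simp: norm_of_real_powr)
      also have "\<dots> \<le> 2 powr Re s" using f2 s by (intro powr_mono2) auto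
      finally have "norm (complex_of_real \<bar>f_flat a b p q z\<bar> powr s) * norm (\<phi> z) \<le> 2 powr Re s * B"
        using B[of z] by (intro mult_mono) auto
      then show ?thesis using True B0 by (simp add: norm_mult)
    qed (use K in simp)
  qed
qed

text \<open>
  The amplitude is \<open>\<psi>(x,y) = \<Sum> \<phi>(\<plusminus>x, \<plusminus>y)\<close>. Adding the Taylor polynomials of \<open>\<phi>\<close> at \<open>(\<plusminus>x, 0)\<close> in the
  directions \<open>\<plusminus>y\<close> produces the factor \<open>1 + (-1)^k\<close> in the coefficients. Coefficients of index at
  least \<open>b\<close> are set to \<open>0\<close> so that one bound covers all of them.
\<close>

lemma test_function_amplitude:
  assumes q: "even q" and \<phi>: "\<phi> \<in> test_functions U" and U: "U \<subseteq> ball (0, 0) 1"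
  shows "\<exists>\<psi> c M. flat_amplitude a b q p \<psi> c M \<and> \<psi> (0, 0) = 4 * \<phi> (0, 0) \<and>
    (\<forall>s. Re s > 0 \<longrightarrow> local_zeta (f_flat a b p q) \<phi> s = flat_amplitude.quadrant_zeta a b q p \<psi> s)"
proof -
  define K where "K = closure {z. \<phi> z \<noteq> 0}"
  have sm: "smooth \<phi>" and K: "compact K" "K \<subseteq> ball (0, 0) 1"
    using \<phi> U by (auto simp: test_functions_def K_def)
  have K0: "\<phi> z = 0" if "z \<notin> K" for z
    using that closure_subset[of "{z. \<phi> z \<noteq> 0}"] by (auto simp: K_def)
  have cont: "continuous_on UNIV \<phi>" using sm by (rule smooth_continuous)
  have "\<forall>k. \<exists>B\<ge>0. \<forall>z. norm (vertical_derivative k \<phi> z) \<le> B"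
    using vertical_derivative_bounded[OF sm K(1) K0] by blast
  then obtain B where B: "\<And>k. B k \<ge> 0" "\<And>k z. norm (vertical_derivative k \<phi> z) \<le> B k"
    by metis
  define M where "M = (\<Sum>k\<le>b. 8 * B k)"
  have M: "8 * B k \<le> M" if "k \<le> b" for k
    unfolding M_def using that B by (intro member_le_sum) auto
  define \<psi> where "\<psi> z = \<phi> (fst z, snd z) + \<phi> (- fst z, snd z) + \<phi> (fst z, - snd z) + \<phi> (- fst z, - snd z)" for z
  define D where "D k x = vertical_derivative k \<phi> (x, 0) + vertical_derivative k \<phi> (- x, 0)" for k x
  define c where "c k x = (if k < b then (1 + (-1) ^ k) * D k x / fact k else 0)" for k x
  have \<phi>b: "norm (\<phi> z) \<le> B 0" for z using B(2)[of 0 z] by simp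
  have \<psi>c: "continuous_on UNIV \<psi>"
    unfolding \<psi>_def by (intro continuous_intros continuous_on_compose2[OF cont]) auto
  have zero: "\<phi> (x, y) = 0" if "\<bar>x\<bar> \<ge> 1 \<or> \<bar>y\<bar> \<ge> 1" for x y
  proof (rule K0, rule notI)
    assume "(x, y) \<in> K"
    then have "norm (x, y) < 1" using K(2) by (auto simp: subset_eq zero_prod_def[symmetric])
    then show False using that norm_fst_le[of x y] norm_snd_le[of y x] by auto
  qed
  have amp: "flat_amplitude a b q p \<psi> c M"
  proof (unfold_locales)
    show "\<psi> \<in> borel_measurable borel" using \<psi>c by (rule borel_measurable_continuous_onI)
    show "norm (\<psi> z) \<le> M" for z
    proof -
      have "norm (\<psi> z) \<le> B 0 + B 0 + B 0 + B 0"
        unfolding \<psi>_def by (intro norm_triangle_mono \<phi>b)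
      then show ?thesis using M[of 0] B(1)[of 0] by simp
    qed
    show "\<psi> z = 0" if "fst z > 0" "snd z > 0" "z \<notin> usquare" for z
      using that by (cases z) (auto simp: \<psi>_def zero)
    show "isCont \<psi> (0, 0)" using \<psi>c by (simp add: continuous_on_eq_continuous_at)
    show "c k \<in> borel_measurable borel" for k
    proof -
      have vc: "continuous_on UNIV (vertical_derivative k \<phi>)"
        by (intro smooth_continuous smooth_vertical_derivative sm)
      have "continuous_on UNIV (D k)"
        unfolding D_def by (intro continuous_intros continuous_on_compose2[OF vc]) auto
      then have "continuous_on UNIV (c k)"
        unfolding c_def by (cases "k < b") (auto intro!: continuous_intros)
      then show ?thesis by (rule borel_measurable_continuous_onI)
    qed
    show "norm (c k x) \<le> M" for k x
    proof (cases "k < b")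
      case True
      have "norm (D k x) \<le> 2 * B k"
        using norm_triangle_mono[OF B(2)[of k "(x, 0)"] B(2)[of k "(- x, 0)"]] by (simp add: D_def)
      moreover have "norm (1 + (-1) ^ k :: complex) \<le> 2" by (cases "even k") auto
      ultimately have "norm (1 + (-1) ^ k :: complex) * norm (D k x) / fact k \<le> 2 * (2 * B k) / 1"
        using B(1)[of k] by (intro frac_le mult_mono) auto
      then have "norm (c k x) \<le> 4 * B k" using True by (simp add: c_def norm_mult norm_divide)
      then show ?thesis using M[of k] True B(1)[of k] by simp
    next
      case False
      then show ?thesis using M[of 0] B(1)[of 0] by (simp add: c_def)
    qed
    show "c k x = 0" if "odd k" for k x using that by (simp add: c_def)
    show "norm (\<psi> (x, y) - (\<Sum>k<b. c k x * of_real y ^ k)) \<le> M * y ^ b" if "(x, y) \<in> usquare" for x y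
    proof -
      have y: "y > 0" using that by simp
      let ?E = "\<lambda>x y. \<phi> (x, y) - (\<Sum>k<b. vertical_derivative k \<phi> (x, 0) * of_real y ^ k / fact k)"
      have E: "norm (?E x y') \<le> 2 * B b * y ^ b" if "\<bar>y'\<bar> = y" for x y'
        using vertical_taylor[OF sm _ B(2)[of b], of x y'] ab that by simp
      have pw: "of_real (- y) ^ k = (-1) ^ k * (of_real y ^ k :: complex)" for k
        by (simp add: power_minus[of "complex_of_real y"])
      have "c k x * of_real y ^ k = vertical_derivative k \<phi> (x, 0) * of_real y ^ k / fact k
          + vertical_derivative k \<phi> (- x, 0) * of_real y ^ k / fact k
          + vertical_derivative k \<phi> (x, 0) * of_real (- y) ^ k / fact k
          + vertical_derivative k \<phi> (- x, 0) * of_real (- y) ^ k / fact k" if "k < b" for k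
        using that unfolding c_def D_def pw by (simp add: field_simps)
      then have "\<psi> (x, y) - (\<Sum>k<b. c k x * of_real y ^ k) = ?E x y + ?E (- x) y + ?E x (- y) + ?E (- x) (- y)"
        by (simp add: \<psi>_def sum.distrib)
      also have "norm \<dots> \<le> 2 * B b * y ^ b + 2 * B b * y ^ b + 2 * B b * y ^ b + 2 * B b * y ^ b"
        using y by (intro norm_triangle_mono E) auto
      also have "\<dots> = 8 * B b * y ^ b" by simp
      also have "\<dots> \<le> M * y ^ b" using y by (intro mult_right_mono M) auto
      finally show ?thesis .
    qed
  qed
  have "local_zeta (f_flat a b p q) \<phi> s = flat_amplitude.quadrant_zeta a b q p \<psi> s" if s: "Re s > 0" for s
  proof -
    let ?h = "\<lambda>z. complex_of_real \<bar>f_flat a b p q z\<bar> powr s * \<phi> z"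
    have "local_zeta (f_flat a b p q) \<phi> s = (LINT z|lborel. indicator quadrant z *\<^sub>R
     (?h (fst z, snd z) + ?h (- fst z, snd z) + ?h (fst z, - snd z) + ?h (- fst z, - snd z)))"
      unfolding local_zeta_def
      by (rule integral_fold_quadrant[OF local_zeta_integrable[OF q s cont K K0 \<phi>b]])
    also have "\<dots> = (LINT z|lborel. indicator usquare z *\<^sub>R
       (complex_of_real (leading z * (1 + ratio z)) powr s * \<psi> z))"
    proof (intro Bochner_Integration.integral_cong refl)
      fix z :: "real \<times> real"
      have "?h (fst z, snd z) + ?h (- fst z, snd z) + ?h (fst z, - snd z) + ?h (- fst z, - snd z)
         = complex_of_real \<bar>f_flat a b p q z\<bar> powr s * \<psi> z"
        using f_flat_abs[OF q qa, of b p "fst z" "snd z"] f_flat_abs[OF q qa, of b p "- fst z" "snd z"]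
          f_flat_abs[OF q qa, of b p "fst z" "- snd z"] f_flat_abs[OF q qa, of b p "- fst z" "- snd z"]
        by (simp add: \<psi>_def distrib_left)
      moreover have "\<bar>f_flat a b p q z\<bar> = leading z * (1 + ratio z)" if "z \<in> quadrant"
        using that f_flat_factor[of z] leading_pos[of z] ratio_pos[of z] by (cases z) (auto simp: abs_mult)
      moreover have "\<psi> z = 0" if "z \<in> quadrant" "z \<notin> usquare"
        using that flat_amplitude.amplitude_support[OF amp, of z] by (cases z) auto
      moreover have "z \<in> quadrant" if "z \<in> usquare" using that by auto
      ultimately show "indicator quadrant z *\<^sub>R
          (?h (fst z, snd z) + ?h (- fst z, snd z) + ?h (fst z, - snd z) + ?h (- fst z, - snd z))
        = indicator usquare z *\<^sub>R (complex_of_real (leading z * (1 + ratio z)) powr s * \<psi> z)"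
        by (cases "z \<in> quadrant"; cases "z \<in> usquare") (simp_all)
    qed
    also have "\<dots> = flat_amplitude.quadrant_zeta a b q p \<psi> s"
      by (simp only: flat_amplitude.quadrant_zeta_def[OF amp])
    finally show ?thesis .
  qed
  then show ?thesis using amp by (intro exI[of _ \<psi>] exI[of _ c] exI[of _ M]) (simp add: \<psi>_def)
qed

end

section \<open>A bump function\<close>

text \<open>
  The functions \<open>t^(-m) exp (-1/t)\<close>, extended by \<open>0\<close>. Their span is closed under differentiation, so
  differentiability alone makes them smooth.
\<close>

definition eta :: "nat \<Rightarrow> real \<Rightarrow> real" where
  "eta m t = (if t > 0 then inverse t ^ m * exp (- inverse t) else 0)"

lemma eta_bounded: "\<exists>C. \<forall>t. \<bar>eta m t\<bar> \<le> C"
proof -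
  obtain C where C: "C \<ge> 0" "\<And>t. t > 0 \<Longrightarrow> t powr real m * exp (- 1 * t) \<le> C"
    using powr_mult_exp_minus_bounded[of 1 "real m"] by auto
  have "\<bar>eta m t\<bar> \<le> C" for t
    using C(2)[of "inverse t"] C(1) by (auto simp: eta_def powr_realpow)
  then show ?thesis by blast
qed

lemma eta_has_derivative:
  "(eta m has_real_derivative eta (m + 2) t - real m * eta (m + 1) t) (at t)"
proof -
  consider "t > 0" | "t < 0" | "t = 0" by linarith
  then show ?thesis
  proof cases
    case 1
    have "((\<lambda>t. inverse t ^ m * exp (- inverse t)) has_real_derivative
       (real m * (- (inverse t * 1 * inverse t) * inverse t ^ (m - 1)) * exp (- inverse t)
        + inverse t ^ m * (exp (- inverse t) * (inverse t * inverse t)))) (at t)"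
      using 1 by (auto intro!: derivative_eq_intros simp: power2_eq_square)
    moreover have "real m * (- (inverse t * 1 * inverse t) * inverse t ^ (m - 1)) * exp (- inverse t)
        + inverse t ^ m * (exp (- inverse t) * (inverse t * inverse t))
      = eta (m + 2) t - real m * eta (m + 1) t"
      using 1 by (cases m) (simp_all add: eta_def algebra_simps)
    ultimately have "((\<lambda>t. inverse t ^ m * exp (- inverse t)) has_real_derivative eta (m + 2) t - real m * eta (m + 1) t) (at t)"
      by (simp only:)
    then show ?thesis
      by (rule DERIV_cong_ev[THEN iffD1, OF refl _ refl, rotated])
         (use 1 eventually_nhds_in_open[of "{0<..}" t] in \<open>auto simp: eta_def elim!: eventually_mono\<close>)
  next
    case 2
    have "((\<lambda>_. 0) has_real_derivative 0) (at t)" by simp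
    then have "(eta m has_real_derivative 0) (at t)"
      by (rule DERIV_cong_ev[THEN iffD1, OF refl _ refl, rotated])
         (use 2 eventually_nhds_in_open[of "{..<0}" t] in \<open>auto simp: eta_def elim!: eventually_mono\<close>)
    then show ?thesis using 2 by (simp add: eta_def)
  next
    case 3
    obtain C where C: "\<And>t. \<bar>eta (m + 2) t\<bar> \<le> C" using eta_bounded by blast
    \<comment> \<open>\<open>eta m h = h\<^sup>2 * eta (m + 2) h\<close> vanishes to second order at \<open>0\<close>.\<close>
    have "((\<lambda>h. (eta m (0 + h) - eta m 0) / h) \<longlongrightarrow> 0) (at 0)"
    proof (rule Lim_null_comparison)
      show "\<forall>\<^sub>F h in at 0. norm ((eta m (0 + h) - eta m 0) / h) \<le> C * \<bar>h\<bar>"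
      proof (intro always_eventually allI)
        fix h :: real
        have "eta m h = eta (m + 2) h * h\<^sup>2"
          by (auto simp: eta_def power2_eq_square field_simps)
        then have "norm ((eta m (0 + h) - eta m 0) / h) = \<bar>eta (m + 2) h\<bar> * \<bar>h\<bar>"
          by (cases "h = 0") (auto simp: eta_def abs_mult power2_eq_square)
        then show "norm ((eta m (0 + h) - eta m 0) / h) \<le> C * \<bar>h\<bar>"
          using C[of h] by (simp add: mult_right_mono)
      qed
      show "((\<lambda>h. C * \<bar>h\<bar>) \<longlongrightarrow> 0) (at 0)" by (auto intro!: tendsto_eq_intros)
    qed
    then have "(eta m has_real_derivative 0) (at 0)" by (simp add: DERIV_def)
    then show ?thesis using 3 by (simp add: eta_def)
  qed
qed

text \<open>
  An algebra of functions that contains a bump function on the disc of radius \<open>r\<close> and is closed under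
  directional derivatives, which is the form in which smoothness is defined.
\<close>

inductive bump_algebra :: "real \<Rightarrow> (real \<times> real \<Rightarrow> complex) \<Rightarrow> bool" for r :: real where
  const: "bump_algebra r (\<lambda>_. c)"
| fst: "bump_algebra r (\<lambda>z. of_real (fst z))"
| snd: "bump_algebra r (\<lambda>z. of_real (snd z))"
| eta: "bump_algebra r (\<lambda>z. of_real (eta m (r\<^sup>2 - ((fst z)\<^sup>2 + (snd z)\<^sup>2))))"
| add: "bump_algebra r g \<Longrightarrow> bump_algebra r h \<Longrightarrow> bump_algebra r (\<lambda>z. g z + h z)"
| mult: "bump_algebra r g \<Longrightarrow> bump_algebra r h \<Longrightarrow> bump_algebra r (\<lambda>z. g z * h z)"

lemma bump_algebra_derivative:
  assumes "bump_algebra r g"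
  shows "\<exists>D. (\<forall>z. (g has_derivative D z) (at z)) \<and> (\<forall>v. bump_algebra r (\<lambda>z. D z v))"
  using assms
proof induction
  case (const c)
  show ?case by (intro exI[of _ "\<lambda>_ _. 0"]) (auto intro: bump_algebra.const)
next
  case fst
  show ?case
    by (intro exI[of _ "\<lambda>_ v. of_real (fst v)"])
       (auto intro!: bump_algebra.const derivative_eq_intros)
next
  case snd
  show ?case
    by (intro exI[of _ "\<lambda>_ v. of_real (snd v)"])
       (auto intro!: bump_algebra.const derivative_eq_intros)
next
  case (eta m)
  let ?h = "\<lambda>z :: real \<times> real. r\<^sup>2 - ((fst z)\<^sup>2 + (snd z)\<^sup>2)"
  let ?D = "\<lambda>z v. complex_of_real ((eta (m + 2) (?h z) - real m * eta (m + 1) (?h z)) * (- 2 * (fst z * fst v + snd z * snd v)))"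
  have d: "((\<lambda>z. complex_of_real (eta m (?h z))) has_derivative ?D z) (at z)" for z
  proof -
    have h: "(?h has_derivative (\<lambda>v. - 2 * (fst z * fst v + snd z * snd v))) (at z)"
      by (auto intro!: derivative_eq_intros simp: algebra_simps)
    have "((\<lambda>z. eta m (?h z)) has_derivative (\<lambda>v. (eta (m + 2) (?h z) - real m * eta (m + 1) (?h z)) * (- 2 * (fst z * fst v + snd z * snd v)))) (at z)"
      using has_derivative_compose[OF h eta_has_derivative[of m "?h z", unfolded has_field_derivative_def]]
      by simp
    then show ?thesis by (rule has_derivative_of_real)
  qed
  have alg: "bump_algebra r (\<lambda>z. (of_real (eta (m + 2) (?h z)) + (- of_nat m) * of_real (eta (m + 1) (?h z)))
      * ((- 2 * of_real (fst v)) * of_real (fst z) + (- 2 * of_real (snd v)) * of_real (snd z)))" for v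
    by (intro bump_algebra.intros)
  have "?D z v = (of_real (eta (m + 2) (?h z)) + (- of_nat m) * of_real (eta (m + 1) (?h z)))
      * ((- 2 * of_real (fst v)) * of_real (fst z) + (- 2 * of_real (snd v)) * of_real (snd z))" for z v
    by (simp add: algebra_simps)
  then have "bump_algebra r (\<lambda>z. ?D z v)" for v using alg[of v] by (simp only:)
  then show ?case using d by (intro exI[of _ ?D]) blast
next
  case (add g h)
  then obtain D E where "\<And>z. (g has_derivative D z) (at z)" "\<And>v. bump_algebra r (\<lambda>z. D z v)"
    "\<And>z. (h has_derivative E z) (at z)" "\<And>v. bump_algebra r (\<lambda>z. E z v)" by blast
  then show ?case
    by (intro exI[of _ "\<lambda>z v. D z v + E z v"]) (auto intro!: bump_algebra.add has_derivative_add)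
next
  case (mult g h)
  then obtain D E where "\<And>z. (g has_derivative D z) (at z)" "\<And>v. bump_algebra r (\<lambda>z. D z v)"
    "\<And>z. (h has_derivative E z) (at z)" "\<And>v. bump_algebra r (\<lambda>z. E z v)" by blast
  then show ?case using mult.hyps
    by (intro exI[of _ "\<lambda>z v. g z * E z v + D z v * h z"])
       (auto intro!: bump_algebra.add bump_algebra.mult has_derivative_mult)
qed

lemma bump_algebra_smooth:
  assumes "bump_algebra r g"
  shows "smooth g"
proof -
  have "Ck k g" if "bump_algebra r g" for k g
    using that
  proof (induction k arbitrary: g)
    case 0
    then obtain D where "\<And>z. (g has_derivative D z) (at z)" using bump_algebra_derivative by blast
    then show ?case by (auto intro!: continuous_at_imp_continuous_on has_derivative_continuous)
  next
    case (Suc k)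
    then obtain D where D: "\<And>z. (g has_derivative D z) (at z)" "\<And>v. bump_algebra r (\<lambda>z. D z v)"
      using bump_algebra_derivative by blast
    have "frechet_derivative g (at z) = D z" for z
      using frechet_derivative_at[OF D(1)] by simp
    moreover have "g differentiable (at z)" for z
      using D(1) differentiable_def by blast
    ultimately show ?case using D(2) Suc.IH by simp
  qed
  then show ?thesis using assms by (simp add: smooth_def)
qed

lemma exists_bump:
  assumes "open U" "(0, 0) \<in> U"
  shows "\<exists>\<phi>\<in>test_functions U. (\<forall>z. \<phi> z \<in> \<real>) \<and> \<phi> (0, 0) \<noteq> 0"
proof -
  obtain r where r: "r > 0" "cball (0, 0) r \<subseteq> U"
    using assms open_contains_cball by blast
  define \<phi> where "\<phi> z = complex_of_real (eta 0 (r\<^sup>2 - ((fst z)\<^sup>2 + (snd z)\<^sup>2)))" for z :: "real \<times> real"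
  have "z \<in> cball (0, 0) r" if "\<phi> z \<noteq> 0" for z
  proof -
    have "(fst z)\<^sup>2 + (snd z)\<^sup>2 < r\<^sup>2" using that by (auto simp: \<phi>_def eta_def split: if_splits)
    then have "norm z < r" using r by (cases z) (auto simp: norm_Pair intro: real_less_lsqrt)
    then show ?thesis by (simp add: dist_norm zero_prod_def[symmetric] norm_minus_commute)
  qed
  then have sub: "closure {z. \<phi> z \<noteq> 0} \<subseteq> cball (0, 0) r"
    by (intro closure_minimal) auto
  then have "compact (closure {z. \<phi> z \<noteq> 0})"
    using compact_cball closed_closure compact_eq_bounded_closed bounded_subset by metis
  moreover have "smooth \<phi>"
    unfolding \<phi>_def by (rule bump_algebra_smooth[OF bump_algebra.eta])
  moreover have "\<phi> (0, 0) \<noteq> 0" using r by (simp add: \<phi>_def eta_def)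
  ultimately show ?thesis
    using sub r by (intro bexI[of _ \<phi>]) (auto simp: test_functions_def \<phi>_def)
qed

section \<open>The local zeta function\<close>

context flat_phase
begin

lemma zeta_continuable_half_plane:
  assumes "even q" "\<phi> \<in> test_functions U" "U \<subseteq> ball (0, 0) 1"
  shows "zeta_continuable (f_flat a b p q) \<phi> half_plane"
proof -
  obtain \<psi> c M where amp: "flat_amplitude a b q p \<psi> c M"
    and eq: "\<And>s. Re s > 0 \<Longrightarrow> local_zeta (f_flat a b p q) \<phi> s = flat_amplitude.quadrant_zeta a b q p \<psi> s"
    using test_function_amplitude[OF assms] by blast
  interpret flat_amplitude a b q p \<psi> c M by (rule amp)
  show ?thesis
    unfolding zeta_continuable_def
    using continued_zeta_meromorphic continued_zeta_eq eq by (intro exI[of _ continued_zeta]) auto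
qed

lemma not_zeta_continuable_past:
  assumes "even q" "\<phi> \<in> test_functions U" "U \<subseteq> ball (0, 0) 1" and \<phi>0: "\<phi> (0, 0) \<noteq> 0"
    and V: "complex_of_real (- 1 / real a) \<in> V"
    and cond: "p < real b / real a - 1 \<or> \<not> (\<exists>k::int. odd k \<and> real b / real a = of_int k)"
    and nonint: "(real b / real a - 1) / p \<notin> \<int>"
  shows "\<not> zeta_continuable (f_flat a b p q) \<phi> (half_plane \<union> V)"
proof
  assume "zeta_continuable (f_flat a b p q) \<phi> (half_plane \<union> V)"
  then obtain F where F: "F meromorphic_on half_plane \<union> V"
    and Feq: "\<And>s. Re s > 0 \<Longrightarrow> F s = local_zeta (f_flat a b p q) \<phi> s"
    unfolding zeta_continuable_def by blast
  obtain \<psi> c M where amp: "flat_amplitude a b q p \<psi> c M" and \<psi>0: "\<psi> (0, 0) = 4 * \<phi> (0, 0)"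
    and eq: "\<And>s. Re s > 0 \<Longrightarrow> local_zeta (f_flat a b p q) \<phi> s = flat_amplitude.quadrant_zeta a b q p \<psi> s"
    using test_function_amplitude[OF assms(1-3)] by blast
  interpret flat_amplitude a b q p \<psi> c M by (rule amp)
  have "(real b / real a - 1) / p \<in> \<int>"
  proof (rule meromorphic_extension_imp_integer[OF F V])
    show "F s = quadrant_zeta s" if "Re s > 0" for s using Feq eq that by simp
    show "\<psi> (0, 0) \<noteq> 0" using \<psi>0 \<phi>0 by simp
    show "(real b / real a - 1) / p > 1" if "odd j" "real b / real a = of_int j" for j
    proof -
      have "p < real b / real a - 1" using cond that by blast
      then show ?thesis using p0 by simp
    qed
  qed
  then show False using nonint by contradiction
qed

text \<open>
  Every test function is continuable to \<open>Re s > -1/a\<close>, which gives \<open>\<ge>\<close>; a half plane reaching beyond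
  \<open>-1/a\<close> contains a neighbourhood of that point, so a bump function gives \<open>\<le>\<close>.
\<close>

lemma m0_eq:
  assumes "even q" and U: "open U" "(0, 0) \<in> U" "U \<subseteq> ball (0, 0) 1"
    and cond: "p < real b / real a - 1 \<or> \<not> (\<exists>k::int. odd k \<and> real b / real a = of_int k)"
    and nonint: "(real b / real a - 1) / p \<notin> \<int>"
  shows "m0 (f_flat a b p q) U = ereal (1 / real a)"
proof (rule antisym)
  have "ereal (1 / real a) \<le> m0_at (f_flat a b p q) \<phi>" if "\<phi> \<in> test_functions U" for \<phi>
    unfolding m0_at_def
  proof (rule Sup_upper, rule imageI, rule CollectI, intro conjI)
    show "1 / real a > 0" using a2 by simp
    show "\<exists>D. open D \<and> connected D \<and> {s. Re s > - (1 / real a)} \<subseteq> D \<and> zeta_continuable (f_flat a b p q) \<phi> D"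
      using zeta_continuable_half_plane[OF assms(1) that U(3)]
      by (intro exI[of _ half_plane])
         (auto intro!: open_halfspace_Re_gt convex_connected convex_halfspace_Re_gt)
  qed
  then show "ereal (1 / real a) \<le> m0 (f_flat a b p q) U"
    unfolding m0_def by (intro Inf_greatest) auto
next
  obtain \<phi> where \<phi>: "\<phi> \<in> test_functions U" "\<phi> (0, 0) \<noteq> 0"
    using exists_bump[OF U(1,2)] by blast
  have "m0_at (f_flat a b p q) \<phi> \<le> ereal (1 / real a)"
    unfolding m0_at_def
  proof (rule Sup_least)
    fix x assume "x \<in> ereal ` {\<rho>. \<rho> > 0 \<and>
     (\<exists>D. open D \<and> connected D \<and> {s. Re s > - \<rho>} \<subseteq> D \<and> zeta_continuable (f_flat a b p q) \<phi> D)}"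
    then obtain \<rho> D where x: "x = ereal \<rho>" and D: "{s. Re s > - \<rho>} \<subseteq> D" "zeta_continuable (f_flat a b p q) \<phi> D"
      by blast
    have "\<rho> \<le> 1 / real a"
    proof (rule ccontr)
      assume "\<not> \<rho> \<le> 1 / real a"
      then have \<rho>: "- \<rho> < - 1 / real a" by simp
      then have "half_plane \<union> D \<subseteq> D" using D(1) by auto
      then have "zeta_continuable (f_flat a b p q) \<phi> (half_plane \<union> D)"
        using D(2) unfolding zeta_continuable_def by (blast intro: meromorphic_on_subset)
      moreover have "complex_of_real (- 1 / real a) \<in> D"
        using D(1) \<rho> by auto
      ultimately show False
        using not_zeta_continuable_past[OF assms(1) \<phi>(1) U(3) \<phi>(2) _ cond nonint] by blast
    qed
    then show "x \<le> ereal (1 / real a)" by (simp add: x)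
  qed
  then show "m0 (f_flat a b p q) U \<le> ereal (1 / real a)"
    unfolding m0_def using \<phi>(1) by (intro Inf_lower2[of "m0_at (f_flat a b p q) \<phi>"]) auto
qed

end

theorem corollary3p2:
  fixes a b q :: nat and p :: real and f :: "real \<times> real \<Rightarrow> real"
  assumes "2 \<le> a" and "a \<le> b"
    and "p > 0"
    and "even q" and "2 \<le> q" and "q \<le> a"
    and "f = f_flat a b p q"
    and "(0 < p \<and> p < real b / real a - 1)
         \<or> \<not> (\<exists>k::int. odd k \<and> real b / real a = of_int k)"
    and "(real b / real a - 1) / p \<notin> \<int>"
  shows "\<exists>r>0. \<forall>U. open U \<and> (0, 0) \<in> U \<and> U \<subseteq> ball (0, 0) r \<longrightarrow>
    (\<forall>\<phi>\<in>test_functions U. (\<forall>z. \<phi> z \<in> \<real>) \<and> \<phi> (0, 0) \<noteq> 0 \<longrightarrow>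
       zeta_continuable f \<phi> {s. Re s > - 1 / real a} \<and>
       (\<forall>V. open V \<and> complex_of_real (- 1 / real a) \<in> V \<longrightarrow>
          \<not> zeta_continuable f \<phi> ({s. Re s > - 1 / real a} \<union> V)))
    \<and> m0 f U = ereal (1 / real a)"
proof -
  have "a \<noteq> b"
  proof
    assume "a = b"
    then have "(real b / real a - 1) / p = 0" using assms(1) by simp
    then show False using assms(9) by (metis Ints_0)
  qed
  then interpret flat_phase a b q p
    using assms by unfold_locales auto
  have cond: "p < real b / real a - 1 \<or> \<not> (\<exists>k::int. odd k \<and> real b / real a = of_int k)"
    using assms(8) by blast
  show ?thesis
    unfolding assms(7)
  proof (intro exI[of _ 1] conjI allI impI ballI notI)
    fix U :: "(real \<times> real) set"
    assume U: "open U \<and> (0, 0) \<in> U \<and> U \<subseteq> ball (0, 0) 1"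
    then show "m0 (f_flat a b p q) U = ereal (1 / real a)"
      by (intro m0_eq assms(4) cond assms(9)) auto
    fix \<phi> assume \<phi>: "\<phi> \<in> test_functions U" "(\<forall>z. \<phi> z \<in> \<real>) \<and> \<phi> (0, 0) \<noteq> 0"
    show "zeta_continuable (f_flat a b p q) \<phi> half_plane"
      using U by (intro zeta_continuable_half_plane[OF assms(4) \<phi>(1)]) auto
    fix V assume "open V \<and> complex_of_real (- 1 / real a) \<in> V"
    then have "\<not> zeta_continuable (f_flat a b p q) \<phi> (half_plane \<union> V)"
      using U \<phi>(2) by (intro not_zeta_continuable_past[OF assms(4) \<phi>(1) _ _ _ cond assms(9)]) auto
    moreover assume "zeta_continuable (f_flat a b p q) \<phi> (half_plane \<union> V)"
    ultimately show False by contradiction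
  qed simp
qed
end
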